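(* Let $R$ be a commutative ring with $1$, let $m\geq 1$, and suppose $\operatorname{diam}(GF(R))=n$. Then the following hold. (0) If $n=0$, then $\operatorname{diam}(GF(R[[x]]))=1$. (1) If $n=1$, then $\operatorname{diam}(GF(R[[x_1,x_2,\ldots,x_m]]))=2$. (2) If $n=2$, then $\operatorname{diam}(GF(R[[x_1,x_2,\ldots,x_m]]))=2$. (3) If $n\in\{3,4,\infty\}$, then $\operatorname{diam}(GF(R[[x_1,x_2,\ldots,x_m]]))=n$.
   Context: For a commutative ring $T$ with identity, $GF(T)$ is the simple undirected graph whose vertices are the proper ideals of $T$; two distinct proper ideals have an edge between them if and only if, for one of the two orderings $(I,J)$ of the pair, $I\subset J$ and $J/I$ is a finitely generated ideal of $T/I$. The diameter $\operatorname{diam}$ of a graph is the supremum of the distances between pairs of vertices, with $\operatorname{diam}=\infty$ if the graph is not connected. The case $n=0$ corresponds to $R$ being a field (the graph is a single vertex). *)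

theory Defs
  imports "Graph_Theory.Graph_Theory" "HOL-Algebra.QuotRing"
begin

definition fin_gen_ideal :: "('a, 'b) ring_scheme \<Rightarrow> 'a set \<Rightarrow> bool" where
  "fin_gen_ideal T J \<longleftrightarrow> (\<exists>A \<subseteq> carrier T. finite A \<and> J = Idl\<^bsub>T\<^esub> A)"

definition ideal_image :: "('a, 'b) ring_scheme \<Rightarrow> 'a set \<Rightarrow> 'a set \<Rightarrow> 'a set set" where
  "ideal_image T I J = (\<lambda>a. I +>\<^bsub>T\<^esub> a) ` J"

definition fg_below :: "('a, 'b) ring_scheme \<Rightarrow> 'a set \<Rightarrow> 'a set \<Rightarrow> bool" where
  "fg_below T I J \<longleftrightarrow> I \<subset> J \<and> fin_gen_ideal (T Quot I) (ideal_image T I J)"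

definition proper_ideals :: "('a, 'b) ring_scheme \<Rightarrow> 'a set set" where
  "proper_ideals T = {I. ideal I T \<and> I \<noteq> carrier T}"

text \<open>As usual in \<^theory>\<open>Graph_Theory.Digraph\<close>, an undirected graph is a symmetric digraph.\<close>

definition GF :: "('a, 'b) ring_scheme \<Rightarrow> 'a set pair_pre_digraph" where
  "GF T = \<lparr> pverts = proper_ideals T,
            parcs = {(I, J). I \<in> proper_ideals T \<and> J \<in> proper_ideals T \<and>
                             (fg_below T I J \<or> fg_below T J I)} \<rparr>"

lemma GF_simple_undirected: "pair_bidirected_digraph (GF T)"
  by unfold_locales (auto simp: GF_def fg_below_def symmetric_def intro: symI)

text \<open>
  The distance is the library's shortest-path length with all arcs of weight 1; it is
  \<^term>\<open>\<infinity>\<close> when there is no walk. The null graph gets diameter \<^term>\<open>- \<infinity>\<close>. Hence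
  the zero ring, which has no proper ideals, has none of the diameters
  \<^term>\<open>0\<close>, \<dots>, \<^term>\<open>4\<close>, \<^term>\<open>\<infinity>\<close>.
\<close>

definition diam :: "'v pair_pre_digraph \<Rightarrow> ereal" where
  "diam G = (SUP u\<in>pverts G. SUP v\<in>pverts G. wf_digraph.\<mu> (with_proj G) (\<lambda>_. 1) u v)"

text \<open>The exponent vector \<open>e\<close> stands for the monomial $x_1^{e(1)} \cdots x_m^{e(m)}$.\<close>

definition exponents :: "nat \<Rightarrow> (nat \<Rightarrow> nat) set" where
  "exponents m = {e. \<forall>i. i \<notin> {1..m} \<longrightarrow> e i = 0}"

text \<open>
  A power series in $x_1, \ldots, x_m$ over \<open>R\<close> is its coefficient family, and multiplication is
  the Cauchy product (each exponent vector has only finitely many decompositions as a sum).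
\<close>

definition power_series_ring ::
    "('a, 'b) ring_scheme \<Rightarrow> nat \<Rightarrow> ((nat \<Rightarrow> nat) \<Rightarrow> 'a) ring" where
  "power_series_ring R m =
    \<lparr> carrier = (\<Pi>\<^sub>E e\<in>exponents m. carrier R),
      mult = (\<lambda>f g. \<lambda>e\<in>exponents m.
        \<Oplus>\<^bsub>R\<^esub>p\<in>{(a, b) \<in> exponents m \<times> exponents m. (\<lambda>i. a i + b i) = e}.
          f (fst p) \<otimes>\<^bsub>R\<^esub> g (snd p)),
      one = (\<lambda>e\<in>exponents m. if e = (\<lambda>i. 0) then \<one>\<^bsub>R\<^esub> else \<zero>\<^bsub>R\<^esub>),
      zero = (\<lambda>e\<in>exponents m. \<zero>\<^bsub>R\<^esub>),
      add = (\<lambda>f g. \<lambda>e\<in>exponents m. f e \<oplus>\<^bsub>R\<^esub> g e) \<rparr>"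

end

theory Submission
  imports Defs
begin

text \<open>
  Adjacency in the graph is controlled by comaximality. If \<open>I + J\<close> is the whole ring, then
  \<open>I / (I \<inter> J)\<close> and \<open>J / (I \<inter> J)\<close> are cyclic, so that \<open>I\<close> and \<open>J\<close> are at distance at most 2
  (\<open>comaximal_hops\<close>). If \<open>I + J\<close> is proper, then every valley \<open>I \<supseteq> K \<subseteq> J\<close> of the graph can be
  replaced by the peak \<open>I \<subseteq> I + J \<supseteq> J\<close> (\<open>peak_of_valley\<close>). In every commutative ring this gives the
  following picture.

  \<^item> Ideals \<open>I\<close>, \<open>J\<close> that are not comaximal with the same ideals are at distance at most 3
    (\<open>three_hops_of_separated\<close>).
  \<^item> Ideals that are comaximal with the same ideals, and have distance at most 3, are joined by a
    peak (\<open>peak_of_three_hops\<close>).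
  \<^item> If the ring has two comaximal proper ideals, all distances are at most 4
    (\<open>four_hops_of_nonlocal\<close>). If it has none, all connected pairs are joined by a peak
    (\<open>peak_of_hops_local\<close>), and the diameter is at most 2 or infinite.

  Now let \<open>R \<rightarrow> S\<close> be a surjection whose kernel is finitely generated and lies in the Jacobson
  radical. It preserves and reflects comaximality, and peaks lift from the images of two ideals
  to the ideals themselves (\<open>peak_lift\<close>), since the generators of the kernel can be added to
  lifts of the generators in \<open>S\<close>. If the diameter of \<open>S\<close> is at most 2, 3 or 4, then the images of
  any two ideals of \<open>R\<close> whose distance is not already bounded by the remarks above are joined by a
  peak; hence the same bound holds for \<open>R\<close>. All
  bounds pass from \<open>R\<close> to \<open>S\<close>, because paths have images. The constant coefficient of a power
  series is such a surjection (\<open>radical_quotient_const_coeff\<close>), which settles the diameters 2, 3,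
  4 and \<open>\<infinity>\<close>.

  If the coefficient ring has a nonzero proper ideal, containing \<open>c \<noteq> 0\<close> say, then \<open>(c)\<close> and
  \<open>(x\<^sub>1, \<dots>, x\<^sub>m)\<close> are incomparable and the diameter is at least 2, which raises 1 to 2. Over a field,
  the nonzero ideals of the power series ring in one variable are generated by the powers of the
  variable; they form a chain, and the diameter is 1.
\<close>

section \<open>Distances and diameters\<close>

text \<open>Loops are included, so that the \<open>k\<close>-fold iterate relates exactly the pairs of vertices at
distance at most \<open>k\<close>.\<close>

definition hop :: "'v pair_pre_digraph \<Rightarrow> 'v \<Rightarrow> 'v \<Rightarrow> bool" where
  "hop G u v \<longleftrightarrow> u \<in> pverts G \<and> v \<in> pverts G \<and> (u = v \<or> (u, v) \<in> parcs G)"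

lemma hop_pow_mono:
  assumes "(hop G ^^ k) u v" "k \<le> l" "v \<in> pverts G"
  shows "(hop G ^^ l) u v"
proof -
  have "(hop G ^^ j) v v" for j
    by (induction j) (use assms(3) in \<open>auto simp: hop_def\<close>)
  then have "(hop G ^^ k OO hop G ^^ (l - k)) u v"
    using assms(1) by blast
  then show ?thesis
    using assms(2) by (metis relpowp_add le_add_diff_inverse)
qed

lemma (in pair_wf_digraph) awalk_of_hops:
  assumes "(hop G ^^ k) u v" "u \<in> pverts G"
  shows "\<exists>p. awalk u p v \<and> length p \<le> k"
  using assms
proof (induction k arbitrary: u)
  case 0
  then show ?case by (intro exI[of _ "[]"]) (auto simp: awalk_Nil_iff)
next
  case (Suc k)
  then obtain w where w: "hop G u w" "(hop G ^^ k) w v"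
    by (meson relpowp_Suc_E2)
  then obtain p where p: "awalk w p v" "length p \<le> k"
    using Suc.IH[OF w(2)] w(1) unfolding hop_def by blast
  show ?case
  proof (cases "u = w")
    case True
    then show ?thesis using p by auto
  next
    case False
    then have "(u, w) \<in> parcs G" using w(1) by (simp add: hop_def)
    then have "awalk u ((u, w) # p) v"
      using p(1) Suc.prems(2) by (auto simp: awalk_Cons_iff)
    then show ?thesis using p(2) by (intro exI[of _ "(u, w) # p"]) simp
  qed
qed

lemma (in pair_wf_digraph) hops_of_awalk:
  assumes "awalk u p v"
  shows "(hop G ^^ length p) u v"
  using assms
proof (induction p arbitrary: u)
  case Nil
  then show ?case by (simp add: awalk_Nil_iff)
next
  case (Cons e p)
  then have e: "e \<in> parcs G" "fst e = u" "awalk (snd e) p v"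
    by (auto simp: awalk_Cons_iff)
  then have "hop G u (snd e)"
    using wellformed'[of "fst e" "snd e"] by (auto simp: hop_def)
  then show ?case
    using Cons.IH[OF e(3)] by (simp add: relpowp_Suc_I2 del: relpowp.simps)
qed

text \<open>The distance is an infimum of extended reals, but only walk lengths occur in it. Hence a bound
strictly below \<open>k + 1\<close> already yields a walk of length at most \<open>k\<close>; this integrality is what
makes the diameters computable from the relation \<^const>\<open>hop\<close>.\<close>

lemma (in pair_wf_digraph) mu_less_iff_hops:
  assumes "u \<in> pverts G" "v \<in> pverts G"
  shows "wf_digraph.\<mu> (with_proj G) (\<lambda>_. 1) u v < ereal (real (Suc k)) \<longleftrightarrow> (hop G ^^ k) u v"
proof -
  have cost: "awalk_cost (\<lambda>_. 1) p = real (length p)" for p :: "('a \<times> 'a) list"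
    by (induction p) auto
  have "wf_digraph.\<mu> (with_proj G) (\<lambda>_. 1) u v < ereal (real (Suc k)) \<longleftrightarrow>
        (\<exists>p. awalk u p v \<and> length p < Suc k)"
    unfolding \<mu>_def by (subst INF_less_iff) (auto simp: cost simp flip: less_Suc_eq_le of_nat_Suc)
  also have "\<dots> \<longleftrightarrow> (hop G ^^ k) u v"
    using awalk_of_hops hops_of_awalk hop_pow_mono assms by (meson less_Suc_eq_le)
  finally show ?thesis .
qed

lemma (in pair_wf_digraph) mu_le_iff_hops:
  assumes "u \<in> pverts G" "v \<in> pverts G"
  shows "wf_digraph.\<mu> (with_proj G) (\<lambda>_. 1) u v \<le> ereal (real k) \<longleftrightarrow> (hop G ^^ k) u v"
proof
  assume "wf_digraph.\<mu> (with_proj G) (\<lambda>_. 1) u v \<le> ereal (real k)"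
  then have "wf_digraph.\<mu> (with_proj G) (\<lambda>_. 1) u v < ereal (real (Suc k))"
    by (rule order.strict_trans1) simp
  then show "(hop G ^^ k) u v" using assms mu_less_iff_hops by blast
next
  have cost: "awalk_cost (\<lambda>_. 1) p = real (length p)" for p :: "('a \<times> 'a) list"
    by (induction p) auto
  assume "(hop G ^^ k) u v"
  then obtain p where "awalk u p v" "length p \<le> k"
    using awalk_of_hops assms by blast
  then show "wf_digraph.\<mu> (with_proj G) (\<lambda>_. 1) u v \<le> ereal (real k)"
    using min_cost_le_walk_cost[of u p v "\<lambda>_. 1"] by (auto simp: cost intro: order_trans)
qed

lemma (in pair_wf_digraph) diam_le_iff:
  "diam G \<le> ereal (real k) \<longleftrightarrow> (\<forall>u\<in>pverts G. \<forall>v\<in>pverts G. (hop G ^^ k) u v)"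
  by (auto simp: diam_def SUP_le_iff mu_le_iff_hops)

lemma (in pair_wf_digraph) diam_ge_Suc:
  assumes "\<not> diam G \<le> ereal (real k)"
  shows "ereal (real (Suc k)) \<le> diam G"
proof -
  obtain u v where uv: "u \<in> pverts G" "v \<in> pverts G" "\<not> (hop G ^^ k) u v"
    using assms diam_le_iff by blast
  then have "ereal (real (Suc k)) \<le> wf_digraph.\<mu> (with_proj G) (\<lambda>_. 1) u v"
    using mu_less_iff_hops not_less by blast
  also have "\<dots> \<le> diam G"
    unfolding diam_def using uv by (intro SUP_upper2[of u] SUP_upper2[of v] order_refl)
  finally show ?thesis .
qed

section \<open>Finitely generated extensions of ideals\<close>

text \<open>The relation "\<open>J / I\<close> is finitely generated", expressed inside \<open>T\<close>. Taking \<open>A\<close> empty gives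
\<open>J = I\<close>, so the relation is reflexive on ideals, matching the loops of \<^const>\<open>hop\<close>.\<close>

definition fg_ext :: "('a, 'b) ring_scheme \<Rightarrow> 'a set \<Rightarrow> 'a set \<Rightarrow> bool" where
  "fg_ext T I J \<longleftrightarrow> (\<exists>A \<subseteq> carrier T. finite A \<and> J = Idl\<^bsub>T\<^esub> (I \<union> A))"

lemma (in ideal) subset_carrier: "I \<subseteq> carrier R"
  using Icarr by blast

lemma (in ring_hom_ring) ideal_image_surj:
  assumes "h ` carrier R = carrier S" "ideal I R"
  shows "ideal (h ` I) S"
proof -
  interpret I: ideal I R by fact
  have carr: "h ` I \<subseteq> carrier S" using I.Icarr by auto
  show ?thesis
  proof (rule idealI)
    show "ring S" by (rule S.ring_axioms)
    show "subgroup (h ` I) (add_monoid S)"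
    proof
      show "h ` I \<subseteq> carrier (add_monoid S)" using carr by simp
      show "\<one>\<^bsub>add_monoid S\<^esub> \<in> h ` I"
        using imageI[OF I.zero_closed, of h] by simp
    next
      fix x y assume "x \<in> h ` I" "y \<in> h ` I"
      then obtain a b where "a \<in> I" "b \<in> I" "x = h a" "y = h b" by blast
      then show "x \<otimes>\<^bsub>add_monoid S\<^esub> y \<in> h ` I"
        using imageI[OF I.a_closed[of a b], of h] I.Icarr by simp
    next
      fix x assume "x \<in> h ` I"
      then obtain a where a: "a \<in> I" "x = h a" by blast
      then have "\<ominus>\<^bsub>S\<^esub> x = h (\<ominus> a)" using I.Icarr by simp
      then show "inv\<^bsub>add_monoid S\<^esub> x \<in> h ` I"
        using imageI[OF I.a_inv_closed[OF a(1)], of h] by (simp flip: a_inv_def)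
    qed
  next
    fix a x assume "a \<in> h ` I" "x \<in> carrier S"
    then obtain b y where "b \<in> I" "a = h b" "y \<in> carrier R" "x = h y"
      using assms(1) by (metis imageE)
    then show "x \<otimes>\<^bsub>S\<^esub> a \<in> h ` I" "a \<otimes>\<^bsub>S\<^esub> x \<in> h ` I"
      using imageI[OF I.I_l_closed[of b y], of h] imageI[OF I.I_r_closed[of b y], of h] I.Icarr
      by simp_all
  qed
qed

lemma (in ring_hom_ring) image_genideal:
  assumes surj: "h ` carrier R = carrier S" and X: "X \<subseteq> carrier R"
  shows "h ` (Idl X) = Idl\<^bsub>S\<^esub> (h ` X)"
proof
  have "h ` X \<subseteq> carrier S" using X by auto
  then have id: "ideal (Idl\<^bsub>S\<^esub> (h ` X)) S" and sub: "h ` X \<subseteq> Idl\<^bsub>S\<^esub> (h ` X)"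
    by (rule S.genideal_ideal, rule S.genideal_self)
  have "Idl X \<subseteq> {r \<in> carrier R. h r \<in> Idl\<^bsub>S\<^esub> (h ` X)}"
    using X sub by (intro R.genideal_minimal ideal_vimage id) auto
  then show "h ` (Idl X) \<subseteq> Idl\<^bsub>S\<^esub> (h ` X)" by auto
  show "Idl\<^bsub>S\<^esub> (h ` X) \<subseteq> h ` (Idl X)"
    using X by (intro S.genideal_minimal ideal_image_surj surj R.genideal_ideal image_mono R.genideal_self)
qed

text \<open>An ideal containing the kernel is the full preimage of its image.\<close>

lemma (in ring_hom_ring) mem_ideal_of_image:
  assumes "ideal J R" "a_kernel R S h \<subseteq> J" "x \<in> carrier R" "h x \<in> h ` J"
  shows "x \<in> J"
proof -
  interpret J: ideal J R by fact
  obtain y where y: "y \<in> J" "h x = h y" using assms(4) by blast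
  then have "y \<in> carrier R" by (simp add: J.Icarr)
  then have "h (x \<ominus> y) = h y \<oplus>\<^bsub>S\<^esub> \<ominus>\<^bsub>S\<^esub> h y"
    unfolding R.minus_eq using assms(3) y(2) by simp
  also have "\<dots> = \<zero>\<^bsub>S\<^esub>"
    using \<open>y \<in> carrier R\<close> by (intro S.r_neg hom_closed)
  finally have "h (x \<ominus> y) = \<zero>\<^bsub>S\<^esub>" .
  then have "x \<ominus> y \<in> a_kernel R S h"
    unfolding a_kernel_def' using \<open>y \<in> carrier R\<close> assms(3) by blast
  then have "(x \<ominus> y) \<oplus> y \<in> J"
    using assms(2) y(1) by (intro J.a_closed) auto
  moreover have "(x \<ominus> y) \<oplus> y = x"
    unfolding R.minus_eq using \<open>y \<in> carrier R\<close> assms(3) by (metis R.a_assoc R.l_neg R.r_zero R.a_inv_closed)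
  ultimately show ?thesis by simp
qed

context ring
begin

lemma genideal_Un_genideal:
  assumes "X \<subseteq> carrier R" "Y \<subseteq> carrier R"
  shows "Idl (X \<union> Idl Y) = Idl (X \<union> Y)"
proof
  have XY: "X \<union> Y \<subseteq> carrier R" using assms by simp
  have "Idl Y \<subseteq> Idl (X \<union> Y)"
    using genideal_self[OF XY] by (intro genideal_minimal genideal_ideal XY) simp
  then show "Idl (X \<union> Idl Y) \<subseteq> Idl (X \<union> Y)"
    using genideal_self[OF XY] by (intro genideal_minimal genideal_ideal XY) simp
  have *: "X \<union> Idl Y \<subseteq> carrier R"
    using assms ideal.subset_carrier[OF genideal_ideal] by simp
  show "Idl (X \<union> Y) \<subseteq> Idl (X \<union> Idl Y)"
    using genideal_self[OF *] genideal_self[OF assms(2)]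
    by (intro genideal_minimal genideal_ideal *) blast
qed

lemma genideal_of_ideal: "ideal I R \<Longrightarrow> Idl I = I"
  using genideal_minimal[of I I] genideal_self[of I] ideal.subset_carrier[of I R] by blast

lemma genideal_mono:
  assumes "X \<subseteq> Y" "Y \<subseteq> carrier R"
  shows "Idl X \<subseteq> Idl Y"
  using assms genideal_self[of Y] by (intro genideal_minimal genideal_ideal) auto

lemma fg_ext_refl: "ideal I R \<Longrightarrow> fg_ext R I I"
  unfolding fg_ext_def using genideal_of_ideal by (intro exI[of _ "{}"]) simp

lemma fg_extD:
  assumes "fg_ext R I J" "I \<subseteq> carrier R"
  shows "ideal J R" "I \<subseteq> J"
proof -
  obtain A where A: "A \<subseteq> carrier R" "J = Idl (I \<union> A)"
    using assms(1) by (auto simp: fg_ext_def)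
  then have "I \<union> A \<subseteq> carrier R" using assms(2) by simp
  then show "ideal J R" "I \<subseteq> J"
    using A(2) genideal_ideal[of "I \<union> A"] genideal_self[of "I \<union> A"] by auto
qed

lemma fg_ext_trans:
  assumes "fg_ext R I J" "fg_ext R J K" "I \<subseteq> carrier R"
  shows "fg_ext R I K"
proof -
  obtain A B where A: "A \<subseteq> carrier R" "finite A" "J = Idl (I \<union> A)"
    and B: "B \<subseteq> carrier R" "finite B" "K = Idl (J \<union> B)"
    using assms(1,2) by (auto simp: fg_ext_def)
  have "K = Idl (B \<union> Idl (I \<union> A))" using A B by (simp add: Un_commute)
  also have "\<dots> = Idl (B \<union> (I \<union> A))"
    using A B assms(3) by (intro genideal_Un_genideal) auto
  also have "\<dots> = Idl (I \<union> (A \<union> B))" by (simp add: Un_ac)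
  finally show ?thesis
    unfolding fg_ext_def using A B by (intro exI[of _ "A \<union> B"]) simp
qed

text \<open>The generators that lead from \<open>K\<close> up to \<open>J\<close> also lead from any larger \<open>I\<close> up to \<open>I + J\<close>.\<close>

lemma fg_ext_sum:
  assumes "fg_ext R K J" "K \<subseteq> I" "I \<subseteq> carrier R"
  shows "fg_ext R I (Idl (I \<union> J))"
proof -
  obtain A where A: "A \<subseteq> carrier R" "finite A" "J = Idl (K \<union> A)"
    using assms(1) by (auto simp: fg_ext_def)
  have "Idl (I \<union> J) = Idl (I \<union> (K \<union> A))"
    unfolding A(3) using A(1) assms(2,3) by (intro genideal_Un_genideal) auto
  also have "I \<union> (K \<union> A) = I \<union> A" using assms(2) by blast
  finally show ?thesis unfolding fg_ext_def using A(1,2) by (intro exI[of _ A] conjI)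
qed

lemma fg_ext_insert:
  assumes "a \<in> carrier R"
  shows "fg_ext R I (Idl (insert a I))"
  unfolding fg_ext_def using assms by (intro exI[of _ "{a}"]) simp

lemma proper_iff_one_notin: "I \<in> proper_ideals R \<longleftrightarrow> ideal I R \<and> \<one> \<notin> I"
proof -
  have "I = carrier R" if "ideal I R" "\<one> \<in> I"
    using that by (rule ideal.one_imp_carrier)
  moreover have "\<one> \<in> I" if "I = carrier R"
    unfolding that by (rule one_closed)
  ultimately show ?thesis unfolding proper_ideals_def mem_Collect_eq by metis
qed

end

text \<open>The quotient \<open>J / I\<close> is treated as the image of \<open>J\<close> under an arbitrary surjection with kernel \<open>I\<close>.\<close>

lemma (in ring_hom_ring) fin_gen_image_iff:
  assumes surj: "h ` carrier R = carrier S" and J: "ideal J R" and ker: "a_kernel R S h \<subseteq> J"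
  shows "fin_gen_ideal S (h ` J) \<longleftrightarrow> fg_ext R (a_kernel R S h) J"
proof
  let ?K = "a_kernel R S h"
  interpret J: ideal J R by fact
  have KC: "?K \<subseteq> carrier R" unfolding a_kernel_def' by blast
  assume "fin_gen_ideal S (h ` J)"
  then obtain B where B: "finite B" "B \<subseteq> carrier S" "h ` J = Idl\<^bsub>S\<^esub> B"
    unfolding fin_gen_ideal_def by blast
  have "B \<subseteq> h ` J" unfolding B(3) using B(2) by (rule S.genideal_self)
  then obtain A where A: "A \<subseteq> J" "finite A" "B = h ` A"
    using finite_subset_image[OF B(1)] by blast
  have AC: "A \<subseteq> carrier R" using A(1) J.subset_carrier by (rule order_trans)
  have KA: "?K \<union> A \<subseteq> carrier R" using AC KC by (rule Un_least[rotated])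
  have "J \<subseteq> Idl (?K \<union> A)"
  proof
    fix x assume x: "x \<in> J"
    have "h x \<in> h ` (Idl A)"
      unfolding image_genideal[OF surj AC] A(3)[symmetric] B(3)[symmetric] using x by (rule imageI)
    also have "\<dots> \<subseteq> h ` (Idl (?K \<union> A))"
      using KA by (intro image_mono R.genideal_mono Un_upper2)
    finally show "x \<in> Idl (?K \<union> A)"
      using R.genideal_ideal[OF KA] order_trans[OF Un_upper1 R.genideal_self[OF KA]] J.Icarr[OF x]
      by (rule mem_ideal_of_image[rotated 3])
  qed
  moreover have "Idl (?K \<union> A) \<subseteq> J"
    using A(1) ker by (intro R.genideal_minimal J Un_least)
  ultimately show "fg_ext R ?K J"
    unfolding fg_ext_def using A(2) AC by (intro exI[of _ A] conjI equalityI)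
next
  let ?K = "a_kernel R S h"
  have KC: "?K \<subseteq> carrier R" unfolding a_kernel_def' by blast
  assume "fg_ext R ?K J"
  then obtain A where A: "A \<subseteq> carrier R" "finite A" "J = Idl (?K \<union> A)"
    unfolding fg_ext_def by blast
  have KA: "?K \<union> A \<subseteq> carrier R" using A(1) KC by (rule Un_least[rotated])
  have "h ` (?K \<union> A) \<subseteq> insert \<zero>\<^bsub>S\<^esub> (h ` A)"
    unfolding a_kernel_def' by blast
  then have "finite (h ` (?K \<union> A))"
    by (rule finite_subset) (use A(2) in simp)
  moreover have "h ` J = Idl\<^bsub>S\<^esub> (h ` (?K \<union> A))"
    unfolding A(3) using surj KA by (rule image_genideal)
  moreover have "h ` (?K \<union> A) \<subseteq> carrier S"
    unfolding surj[symmetric] using KA by (rule image_mono)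
  ultimately show "fin_gen_ideal S (h ` J)"
    unfolding fin_gen_ideal_def by (intro exI[of _ "h ` (?K \<union> A)"] conjI)
qed

lemma (in ring) fin_gen_quotient_iff:
  assumes I: "ideal I R" and J: "ideal J R" and "I \<subseteq> J"
  shows "fin_gen_ideal (R Quot I) (ideal_image R I J) \<longleftrightarrow> fg_ext R I J"
proof -
  have hom: "ring_hom_ring R (R Quot I) ((+>) I)"
    using I by (rule ideal.rcos_ring_hom_ring)
  have surj: "((+>) I) ` carrier R = carrier (R Quot I)"
    unfolding FactRing_def A_RCOSETS_def' by auto
  have zero: "I +> a = I" if "a \<in> I" for a
    using I is_abelian_group that
    by (intro abelian_subgroup.a_rcos_const abelian_subgroupI3 ideal.axioms(1))
  have "\<zero>\<^bsub>R Quot I\<^esub> = I" by (simp add: FactRing_def)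
  then have ker: "a_kernel R (R Quot I) ((+>) I) = I"
    using zero ideal.Icarr[OF I] ideal.rcos_const_imp_mem[OF I] unfolding a_kernel_def' by auto
  show ?thesis
    using ring_hom_ring.fin_gen_image_iff[OF hom surj J, unfolded ker, OF assms(3)]
    unfolding ideal_image_def .
qed

section \<open>Distances between ideals\<close>

text \<open>Comaximality takes the place of maximal ideals: two ideals are comaximal with the same ideals
exactly if they lie in the same maximal ideals, and in this form no maximal ideal has to be
chosen.\<close>

definition comaximal :: "('a, 'b) ring_scheme \<Rightarrow> 'a set \<Rightarrow> 'a set \<Rightarrow> bool" where
  "comaximal T I J \<longleftrightarrow> (\<exists>a\<in>I. \<exists>b\<in>J. a \<oplus>\<^bsub>T\<^esub> b = \<one>\<^bsub>T\<^esub>)"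

text \<open>A peak is a path \<open>I - L - J\<close> of length at most 2 that first ascends and then descends. Such paths
lift along the quotient maps considered below, because generators can be lifted.\<close>

definition peak :: "('a, 'b) ring_scheme \<Rightarrow> 'a set \<Rightarrow> 'a set \<Rightarrow> bool" where
  "peak T I J \<longleftrightarrow> (\<exists>L\<in>proper_ideals T. fg_ext T I L \<and> fg_ext T J L)"

lemma pair_wf_GF: "pair_wf_digraph (GF T)"
  by unfold_locales (auto simp: GF_def)

lemma pverts_GF [simp]: "pverts (GF T) = proper_ideals T"
  by (simp add: GF_def)

lemmas diam_GF_le_iff = pair_wf_digraph.diam_le_iff[OF pair_wf_GF, unfolded pverts_GF]
lemmas diam_GF_ge_Suc = pair_wf_digraph.diam_ge_Suc[OF pair_wf_GF]

lemma comaximal_mono: "comaximal T I J \<Longrightarrow> I \<subseteq> I' \<Longrightarrow> J \<subseteq> J' \<Longrightarrow> comaximal T I' J'"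
  unfolding comaximal_def by blast

context cring
begin

lemma proper_ideal: "I \<in> proper_ideals R \<Longrightarrow> ideal I R"
  by (simp add: proper_ideals_def)

lemma proper_subset_carrier: "I \<in> proper_ideals R \<Longrightarrow> I \<subseteq> carrier R"
  using proper_ideal ideal.subset_carrier by blast

lemma proper_subideal:
  "ideal I R \<Longrightarrow> I \<subseteq> J \<Longrightarrow> J \<in> proper_ideals R \<Longrightarrow> I \<in> proper_ideals R"
  unfolding proper_iff_one_notin by blast

lemma hop_GF_iff:
  "hop (GF R) I J \<longleftrightarrow>
     I \<in> proper_ideals R \<and> J \<in> proper_ideals R \<and> (fg_ext R I J \<or> fg_ext R J I)"
proof -
  have below: "fg_below R I J \<longleftrightarrow> I \<noteq> J \<and> fg_ext R I J"
    if "I \<in> proper_ideals R" "J \<in> proper_ideals R" for I J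
  proof (cases "I \<subseteq> J")
    case True
    then have "fin_gen_ideal (R Quot I) (ideal_image R I J) \<longleftrightarrow> fg_ext R I J"
      using that by (intro fin_gen_quotient_iff proper_ideal)
    then show ?thesis unfolding fg_below_def using True by blast
  next
    case False
    then show ?thesis
      unfolding fg_below_def using fg_extD(2) proper_subset_carrier that(1) by blast
  qed
  show ?thesis
    unfolding hop_def using below[of I J] below[of J I] fg_ext_refl[of I]
    by (auto simp: GF_def proper_ideal)
qed

lemma hop_up: "I \<in> proper_ideals R \<Longrightarrow> J \<in> proper_ideals R \<Longrightarrow> fg_ext R I J \<Longrightarrow> hop (GF R) I J"
  and hop_down: "I \<in> proper_ideals R \<Longrightarrow> J \<in> proper_ideals R \<Longrightarrow> fg_ext R J I \<Longrightarrow> hop (GF R) I J"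
  by (simp_all add: hop_GF_iff)

lemma comaximal_sym: 
  assumes "comaximal R I J" "I \<subseteq> carrier R" "J \<subseteq> carrier R"
  shows "comaximal R J I"
  using assms a_comm unfolding comaximal_def by (metis subsetD)

lemma genideal_Un_proper:
  assumes "ideal I R" "ideal J R" "\<not> comaximal R I J"
  shows "Idl (I \<union> J) \<in> proper_ideals R"
proof -
  have "\<one> \<notin> I <+> J"
    using assms(3) unfolding set_add_def' comaximal_def by force
  moreover have "I \<union> J \<subseteq> carrier R"
    using assms(1,2) ideal.subset_carrier by blast
  ultimately show ?thesis
    unfolding proper_iff_one_notin using union_genideal[OF assms(1,2)] genideal_ideal by metis
qed

lemma not_comaximal_self:
  assumes "I \<in> proper_ideals R"
  shows "\<not> comaximal R I I"
proof
  assume "comaximal R I I"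
  then obtain a b where "a \<in> I" "b \<in> I" "a \<oplus> b = \<one>" unfolding comaximal_def by blast
  then have "\<one> \<in> I"
    using additive_subgroup.a_closed[OF ideal.axioms(1)[OF proper_ideal[OF assms]], of a b] by simp
  then show False using assms by (simp add: proper_iff_one_notin)
qed

text \<open>The quotient \<open>I / (I \<inter> J)\<close> is isomorphic to \<open>R / J\<close>, hence cyclic. Explicitly, if \<open>a + b = 1\<close>
with \<open>a \<in> I\<close> and \<open>b \<in> J\<close>, then \<open>x = x a + x b\<close> where \<open>x b \<in> I \<inter> J\<close> for every \<open>x \<in> I\<close>.\<close>

lemma fg_ext_Int_of_comaximal:
  assumes I: "ideal I R" and J: "ideal J R" and co: "comaximal R I J"
  shows "fg_ext R (I \<inter> J) I"
proof -
  interpret I: ideal I R by fact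
  interpret J: ideal J R by fact
  obtain a b where ab: "a \<in> I" "b \<in> J" "a \<oplus> b = \<one>"
    using co unfolding comaximal_def by blast
  have [simp]: "a \<in> carrier R" "b \<in> carrier R" using ab I.Icarr J.Icarr by auto
  have sub: "I \<inter> J \<union> {a} \<subseteq> carrier R" using I.Icarr by auto
  have id: "ideal (Idl (I \<inter> J \<union> {a})) R" and gen: "I \<inter> J \<union> {a} \<subseteq> Idl (I \<inter> J \<union> {a})"
    using genideal_ideal[OF sub] genideal_self[OF sub] by blast+
  interpret G: ideal "Idl (I \<inter> J \<union> {a})" R by (rule id)
  have "I \<subseteq> Idl (I \<inter> J \<union> {a})"
  proof
    fix x assume x: "x \<in> I"
    then have [simp]: "x \<in> carrier R" using I.Icarr by simp
    have "x \<otimes> b \<in> I \<inter> J" using x ab(2) I.I_r_closed J.I_l_closed by simp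
    then have "x \<otimes> a \<oplus> x \<otimes> b \<in> Idl (I \<inter> J \<union> {a})"
      using gen G.I_l_closed by (intro G.a_closed) auto
    also have "x \<otimes> a \<oplus> x \<otimes> b = x"
      using ab(3) by (simp flip: r_distr)
    finally show "x \<in> Idl (I \<inter> J \<union> {a})" .
  qed
  moreover have "Idl (I \<inter> J \<union> {a}) \<subseteq> I"
    using ab(1) by (intro genideal_minimal I) auto
  ultimately show ?thesis
    unfolding fg_ext_def by (intro exI[of _ "{a}"] conjI equalityI) auto
qed

lemma comaximal_hops:
  assumes "I \<in> proper_ideals R" "J \<in> proper_ideals R" "comaximal R I J"
  shows "(hop (GF R) ^^ 2) I J"
proof -
  have id: "ideal I R" "ideal J R" using assms proper_ideal by auto
  then have "ideal (I \<inter> J) R" by (rule i_intersect)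
  then have P: "I \<inter> J \<in> proper_ideals R" using proper_subideal assms(1) by blast
  have "hop (GF R) I (I \<inter> J)"
    using assms P id by (intro hop_down fg_ext_Int_of_comaximal)
  moreover have "hop (GF R) (I \<inter> J) J"
    using assms P id comaximal_sym[OF assms(3)] proper_subset_carrier
      fg_ext_Int_of_comaximal[of J I] by (intro hop_up) (auto simp: Int_commute)
  ultimately show ?thesis by (auto simp: numeral_2_eq_2)
qed

lemma hops_trans: "(hop G ^^ k) u v \<Longrightarrow> (hop G ^^ l) v w \<Longrightarrow> (hop G ^^ (k + l)) u w"
  by (auto simp: relpowp_add)

lemma hops_sym:
  assumes "(hop (GF R) ^^ k) I J"
  shows "(hop (GF R) ^^ k) J I"
  using assms
proof (induction k arbitrary: I)
  case (Suc k)
  then obtain X where X: "hop (GF R) I X" "(hop (GF R) ^^ k) X J"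
    by (meson relpowp_Suc_E2)
  then have "hop (GF R) X I" by (auto simp: hop_GF_iff)
  with Suc.IH[OF X(2)] show ?case by (rule relpowp_Suc_I)
qed auto

lemma peak_hops:
  assumes "I \<in> proper_ideals R" "J \<in> proper_ideals R" "peak R I J"
  shows "(hop (GF R) ^^ 2) I J"
proof -
  obtain L where "L \<in> proper_ideals R" "fg_ext R I L" "fg_ext R J L"
    using assms(3) unfolding peak_def by blast
  then have "hop (GF R) I L" "hop (GF R) L J"
    using assms by (auto intro: hop_up hop_down)
  then show ?thesis by (auto simp: numeral_2_eq_2)
qed

text \<open>A descent from \<open>I\<close> to \<open>K\<close> followed by an ascent to \<open>J\<close> can be traded for an ascent to \<open>I + J\<close>
followed by a descent, provided that \<open>I + J\<close> is still a vertex.\<close>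

lemma peak_of_valley:
  assumes "fg_ext R K I" "fg_ext R K J" "K \<in> proper_ideals R" "\<not> comaximal R I J"
  shows "peak R I J"
proof -
  have K: "K \<subseteq> carrier R" using assms(3) proper_subset_carrier by simp
  have "ideal I R" "K \<subseteq> I" "ideal J R" "K \<subseteq> J"
    using fg_extD[OF assms(1) K] fg_extD[OF assms(2) K] by auto
  moreover from this have "I \<subseteq> carrier R" "J \<subseteq> carrier R"
    by (simp_all add: ideal.subset_carrier)
  ultimately show ?thesis
    unfolding peak_def
    using fg_ext_sum[OF assms(2), of I] fg_ext_sum[OF assms(1), of J] genideal_Un_proper[OF _ _ assms(4)]
    by (auto simp: Un_commute)
qed

lemma peak_of_two_hops:
  assumes "hop (GF R) I X" "hop (GF R) X J" "\<not> comaximal R I J"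
  shows "peak R I J"
proof -
  have P: "I \<in> proper_ideals R" "X \<in> proper_ideals R" "J \<in> proper_ideals R"
    using assms by (auto simp: hop_GF_iff)
  note C = P[THEN proper_subset_carrier] and id = P[THEN proper_ideal]
  consider "fg_ext R I X" "fg_ext R X J" | "fg_ext R I X" "fg_ext R J X"
    | "fg_ext R X I" "fg_ext R X J" | "fg_ext R X I" "fg_ext R J X"
    using assms by (auto simp: hop_GF_iff)
  then show ?thesis
  proof cases
    case 1
    then have "fg_ext R I J" using fg_ext_trans C by blast
    then show ?thesis unfolding peak_def using P(3) fg_ext_refl id by blast
  next
    case 2
    then show ?thesis unfolding peak_def using P(2) by blast
  next
    case 3
    then show ?thesis using P(2) assms(3) by (rule peak_of_valley)
  next
    case 4
    then have "fg_ext R J I" using fg_ext_trans C by blast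
    then show ?thesis unfolding peak_def using P(1) fg_ext_refl id by blast
  qed
qed

text \<open>If \<open>a + b = 1\<close> with \<open>a \<in> I\<close> and \<open>b \<in> N\<close>, then \<open>L = J + (b)\<close> is contained in the proper ideal
\<open>J + N\<close> and comaximal with \<open>I\<close>. The path is \<open>I\<close>, \<open>I \<inter> L\<close>, \<open>L\<close>, \<open>J\<close>.\<close>

lemma three_hops_of_comaximal:
  assumes P: "I \<in> proper_ideals R" "J \<in> proper_ideals R"
    and N: "ideal N R" "comaximal R I N" "\<not> comaximal R J N"
  shows "(hop (GF R) ^^ 3) I J"
proof -
  obtain a b where ab: "a \<in> I" "b \<in> N" "a \<oplus> b = \<one>"
    using N(2) unfolding comaximal_def by blast
  have b: "b \<in> carrier R" using ab(2) ideal.Icarr[OF N(1)] by simp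
  have bJ: "insert b J \<subseteq> carrier R" using b P(2) proper_subset_carrier by blast
  define L where "L = Idl (insert b J)"
  have L: "ideal L R" "insert b J \<subseteq> L"
    unfolding L_def using bJ genideal_ideal genideal_self by blast+
  have JN: "Idl (J \<union> N) \<in> proper_ideals R"
    using N(1,3) P(2) proper_ideal by (intro genideal_Un_proper)
  have JNC: "J \<union> N \<subseteq> carrier R"
    using N(1) P(2) proper_subset_carrier ideal.subset_carrier by blast
  have "L \<subseteq> Idl (J \<union> N)"
    unfolding L_def using ab(2) JNC by (intro genideal_mono) auto
  then have LP: "L \<in> proper_ideals R" using JN by (rule proper_subideal[OF L(1)])
  have "comaximal R I L" unfolding comaximal_def using ab L(2) by blast
  then have "(hop (GF R) ^^ 2) I L" using P(1) LP by (intro comaximal_hops)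
  moreover have "hop (GF R) L J"
    using LP P(2) fg_ext_insert[OF b] unfolding L_def by (intro hop_down)
  ultimately show ?thesis by (auto simp: numeral_3_eq_3 numeral_2_eq_2)
qed

lemma three_hops_of_separated:
  assumes "I \<in> proper_ideals R" "J \<in> proper_ideals R"
    and "ideal L R" "comaximal R I L \<noteq> comaximal R J L"
  shows "(hop (GF R) ^^ 3) I J"
proof (cases "comaximal R I L")
  case True
  then show ?thesis using assms by (intro three_hops_of_comaximal) auto
next
  case False
  then have "(hop (GF R) ^^ 3) J I" using assms by (intro three_hops_of_comaximal) auto
  then show ?thesis by (rule hops_sym)
qed

text \<open>Between ideals that cannot be separated by comaximality, every valley on a path of length 3 has
a proper sum, and so the path can be rearranged into a peak. Consecutive steps in the same direction merge, which leaves the two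
alternating patterns to be treated.\<close>

lemma peak_of_three_hops:
  assumes "(hop (GF R) ^^ 3) I J"
    and same: "\<And>L. ideal L R \<Longrightarrow> comaximal R I L \<longleftrightarrow> comaximal R J L"
  shows "peak R I J"
proof -
  obtain X Y where h: "hop (GF R) I X" "hop (GF R) X Y" "hop (GF R) Y J"
    using assms(1) by (auto simp: numeral_3_eq_3)
  have P: "I \<in> proper_ideals R" "X \<in> proper_ideals R" "Y \<in> proper_ideals R" "J \<in> proper_ideals R"
    using h by (auto simp: hop_GF_iff)
  note C = P[THEN proper_subset_carrier] and id = P[THEN proper_ideal]
  have IJ: "\<not> comaximal R I J"
    using same[OF id(4)] not_comaximal_self[OF P(4)] by simp
  consider (merge1) "hop (GF R) I Y" | (merge2) "hop (GF R) X J"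
    | (up) "fg_ext R I X" "fg_ext R Y X" "fg_ext R Y J"
    | (down) "fg_ext R X I" "fg_ext R X Y" "fg_ext R J Y"
    using h fg_ext_trans C by (meson hop_GF_iff)
  then show ?thesis
  proof cases
    case merge1
    then show ?thesis using h(3) IJ by (rule peak_of_two_hops)
  next
    case merge2
    then show ?thesis using h(1) IJ by (intro peak_of_two_hops)
  next
    case up
    have "\<not> comaximal R X J"
    proof
      assume "comaximal R X J"
      then have "comaximal R J X" using C(2,4) by (rule comaximal_sym)
      then have "comaximal R I X" using same id by simp
      then have "comaximal R X X" using fg_extD(2)[OF up(1) C(1)] by (rule comaximal_mono) simp
      then show False using not_comaximal_self P by blast
    qed
    then have "peak R X J" using up(2,3) P by (intro peak_of_valley)
    then show ?thesis unfolding peak_def using up(1) fg_ext_trans C by blast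
  next
    case down
    have "\<not> comaximal R I Y"
    proof
      assume "comaximal R I Y"
      then have "comaximal R J Y" using same id by simp
      then have "comaximal R Y Y" using fg_extD(2)[OF down(3) C(4)] by (rule comaximal_mono) simp
      then show False using not_comaximal_self P by blast
    qed
    then have "peak R I Y" using down(1,2) P by (intro peak_of_valley)
    then show ?thesis unfolding peak_def using down(3) fg_ext_trans C by blast
  qed
qed

text \<open>If some proper \<open>L\<close> is comaximal with both ideals, the path runs through \<open>I \<inter> L\<close>, \<open>L\<close> and
\<open>L \<inter> J\<close>. Otherwise both ideals lie in the Jacobson radical; then splitting \<open>1 = a + b\<close> along
the two given ideals makes \<open>I + (a)\<close> and \<open>J + (b)\<close> proper and comaximal, and the path runs
through them and their intersection.\<close>

lemma four_hops_of_nonlocal: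
  assumes N: "N \<in> proper_ideals R" "N' \<in> proper_ideals R" "comaximal R N N'"
    and P: "I \<in> proper_ideals R" "J \<in> proper_ideals R"
  shows "(hop (GF R) ^^ 4) I J"
proof (cases "\<forall>L. ideal L R \<longrightarrow> (comaximal R I L \<longleftrightarrow> comaximal R J L)")
  case False
  then obtain L where L: "ideal L R" "comaximal R I L \<noteq> comaximal R J L" by blast
  then have "(hop (GF R) ^^ 3) I J" using P by (intro three_hops_of_separated)
  then show ?thesis by (rule hop_pow_mono) (use P in auto)
next
  case same: True
  show ?thesis
  proof (cases "\<exists>L\<in>proper_ideals R. comaximal R I L")
    case True
    then obtain L where L: "L \<in> proper_ideals R" "comaximal R I L" by blast
    then have "comaximal R J L" using same proper_ideal by blast
    then have "comaximal R L J" using L(1) P(2) proper_subset_carrier comaximal_sym by blast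
    then have "(hop (GF R) ^^ (2 + 2)) I J"
      using L P by (intro hops_trans[where v = L] comaximal_hops)
    then show ?thesis by simp
  next
    case False
    obtain a b where ab: "a \<in> N" "b \<in> N'" "a \<oplus> b = \<one>"
      using N(3) unfolding comaximal_def by blast
    have ext: "\<exists>K\<in>proper_ideals R. x \<in> K \<and> fg_ext R X K"
      if X: "X \<in> proper_ideals R" "\<not> comaximal R X M" and M: "M \<in> proper_ideals R" "x \<in> M" for X M x
    proof -
      have x: "x \<in> carrier R" using M proper_subset_carrier by blast
      have sub: "insert x X \<subseteq> carrier R" using x X proper_subset_carrier by blast
      have "Idl (insert x X) \<subseteq> Idl (X \<union> M)"
        using M X proper_subset_carrier by (intro genideal_mono) auto
      then have "Idl (insert x X) \<in> proper_ideals R"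
        using genideal_Un_proper[OF _ _ X(2)] X M proper_ideal genideal_ideal[OF sub] proper_subideal
        by blast
      moreover have "x \<in> Idl (insert x X)" using genideal_self[OF sub] by blast
      ultimately show ?thesis using fg_ext_insert[OF x] by blast
    qed
    have no: "\<not> comaximal R I N" "\<not> comaximal R J N'"
      using False same N proper_ideal by blast+
    obtain I' where I': "I' \<in> proper_ideals R" "a \<in> I'" "fg_ext R I I'"
      using ext[OF P(1) no(1) N(1) ab(1)] by blast
    obtain J' where J': "J' \<in> proper_ideals R" "b \<in> J'" "fg_ext R J J'"
      using ext[OF P(2) no(2) N(2) ab(2)] by blast
    have "comaximal R I' J'" unfolding comaximal_def using I' J' ab by blast
    then have "(hop (GF R) ^^ 2) I' J'" using I' J' by (intro comaximal_hops)
    moreover have "hop (GF R) I I'" "hop (GF R) J' J" 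
      using I' J' P by (auto intro: hop_up hop_down)
    ultimately have "(hop (GF R) ^^ Suc (Suc 2)) I J"
      by (meson relpowp_Suc_I relpowp_Suc_I2)
    then show ?thesis by (simp add: eval_nat_numeral)
  qed
qed

text \<open>In a local ring every valley can be turned into a peak, so that any path, of whatever length,
collapses to a peak.\<close>

lemma peak_of_hops_local:
  assumes loc: "\<And>N N'. N \<in> proper_ideals R \<Longrightarrow> N' \<in> proper_ideals R \<Longrightarrow> \<not> comaximal R N N'"
    and "(hop (GF R) ^^ k) I J" "J \<in> proper_ideals R"
  shows "peak R I J"
  using assms(2)
proof (induction k arbitrary: I)
  case 0
  then show ?case
    using assms(3) fg_ext_refl proper_ideal unfolding peak_def by auto
next
  case (Suc k)
  then obtain X where X: "hop (GF R) I X" "(hop (GF R) ^^ k) X J"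
    by (meson relpowp_Suc_E2)
  obtain L where L: "L \<in> proper_ideals R" "fg_ext R X L" "fg_ext R J L"
    using Suc.IH[OF X(2)] unfolding peak_def by blast
  have "hop (GF R) X L" using X(1) L by (intro hop_up) (auto simp: hop_GF_iff)
  then have "peak R I L" using X(1) L by (intro peak_of_two_hops loc) (auto simp: hop_GF_iff)
  then show ?case
    using L(3) fg_ext_trans proper_subset_carrier[OF assms(3)] unfolding peak_def by blast
qed

end

section \<open>Lifting along a quotient by a finitely generated ideal in the Jacobson radical\<close>

text \<open>The ring \<open>S\<close> is the quotient of \<open>R\<close>. The last assumption says that \<open>1 + x\<close> is a unit for all \<open>x\<close>
in the kernel, that is, that the kernel lies in the Jacobson radical of \<open>R\<close>.\<close>

locale radical_quotient = ring_hom_cring +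
  assumes surj: "h ` carrier R = carrier S"
    and kernel_fin_gen: "fin_gen_ideal R (a_kernel R S h)"
    and unit_lift: "\<lbrakk>u \<in> carrier R; h u = \<one>\<^bsub>S\<^esub>\<rbrakk> \<Longrightarrow> u \<in> Units R"
begin

lemma hom_ring: "ring_hom_ring R S h"
  by (rule ring_hom_ringI2) (auto intro: R.ring_axioms S.ring_axioms homh)

lemmas image_genideal = ring_hom_ring.image_genideal[OF hom_ring surj]

definition preimage :: "'c set \<Rightarrow> 'a set" where
  "preimage L = {r \<in> carrier R. h r \<in> L}"

lemma ideal_preimage: "ideal L S \<Longrightarrow> ideal (preimage L) R"
  unfolding preimage_def using hom_ring by (rule ring_hom_ring.ideal_vimage)

lemma image_preimage:
  assumes "ideal L S"
  shows "h ` preimage L = L"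
  using ideal.subset_carrier[OF assms] unfolding preimage_def surj[symmetric] by blast

lemma preimage_proper: "L \<in> proper_ideals S \<Longrightarrow> preimage L \<in> proper_ideals R"
  unfolding R.proper_iff_one_notin S.proper_iff_one_notin
  using ideal_preimage by (simp add: preimage_def)

text \<open>Since the kernel lies in the Jacobson radical, no proper ideal becomes the unit ideal in \<open>S\<close>.\<close>

lemma image_proper:
  assumes "I \<in> proper_ideals R"
  shows "h ` I \<in> proper_ideals S"
proof -
  interpret I: ideal I R using assms by (rule R.proper_ideal)
  have False if one: "\<one>\<^bsub>S\<^esub> \<in> h ` I"
  proof -
    obtain u where u: "\<one>\<^bsub>S\<^esub> = h u" "u \<in> I" using one by (rule imageE)
    have "u \<in> carrier R" using u(2) by (rule I.Icarr)
    then have U: "u \<in> Units R" using u(1)[symmetric] by (rule unit_lift)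
    have "inv u \<otimes> u \<in> I" using u(2) R.Units_inv_closed[OF U] by (rule I.I_l_closed)
    then have "\<one> \<in> I" unfolding R.Units_l_inv[OF U] .
    then show False using assms by (simp add: R.proper_iff_one_notin)
  qed
  then show ?thesis
    unfolding S.proper_iff_one_notin
    using ring_hom_ring.ideal_image_surj[OF hom_ring surj I.is_ideal] by blast
qed

lemma comaximal_image_iff:
  assumes I: "ideal I R" and J: "ideal J R"
  shows "comaximal S (h ` I) (h ` J) \<longleftrightarrow> comaximal R I J"
proof
  interpret I: ideal I R by fact
  interpret J: ideal J R by fact
  assume "comaximal S (h ` I) (h ` J)"
  then obtain a b where ab: "a \<in> I" "b \<in> J" "h a \<oplus>\<^bsub>S\<^esub> h b = \<one>\<^bsub>S\<^esub>"
    unfolding comaximal_def by blast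
  then have C: "a \<in> carrier R" "b \<in> carrier R" using I.Icarr J.Icarr by auto
  then have U: "a \<oplus> b \<in> Units R" using ab(3) by (intro unit_lift) simp_all
  then have iC: "inv (a \<oplus> b) \<in> carrier R" by simp
  have "inv (a \<oplus> b) \<otimes> a \<oplus> inv (a \<oplus> b) \<otimes> b = \<one>"
    using U C iC by (simp flip: R.r_distr)
  then show "comaximal R I J"
    unfolding comaximal_def using I.I_l_closed[OF ab(1) iC] J.I_l_closed[OF ab(2) iC] by blast
next
  assume "comaximal R I J"
  then obtain a b where ab: "a \<in> I" "b \<in> J" "a \<oplus> b = \<one>"
    unfolding comaximal_def by blast
  then have C: "a \<in> carrier R" "b \<in> carrier R" using ideal.Icarr[OF I] ideal.Icarr[OF J] by auto
  have "h a \<oplus>\<^bsub>S\<^esub> h b = h (a \<oplus> b)" using C by simp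
  also have "\<dots> = \<one>\<^bsub>S\<^esub>" unfolding ab(3) by simp
  finally show "comaximal S (h ` I) (h ` J)" unfolding comaximal_def using ab by blast
qed

lemma comaximal_image_left_iff:
  assumes "ideal I R" "ideal L S"
  shows "comaximal S (h ` I) L \<longleftrightarrow> comaximal R I (preimage L)"
  using comaximal_image_iff[OF assms(1) ideal_preimage[OF assms(2)]]
  unfolding image_preimage[OF assms(2)] .

lemma fg_ext_image:
  assumes "fg_ext R I J" "I \<subseteq> carrier R"
  shows "fg_ext S (h ` I) (h ` J)"
proof -
  obtain A where A: "A \<subseteq> carrier R" "finite A" "J = Idl (I \<union> A)"
    using assms(1) unfolding fg_ext_def by blast
  then have "h ` J = Idl\<^bsub>S\<^esub> (h ` I \<union> h ` A)"
    using assms(2) image_genideal[of "I \<union> A"] by (simp add: image_Un)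
  moreover have "h ` A \<subseteq> carrier S" using A(1) by auto
  ultimately show ?thesis
    unfolding fg_ext_def using A(2) by (intro exI[of _ "h ` A"] conjI finite_imageI)
qed

text \<open>The preimage of \<open>L\<close> is generated over \<open>I\<close> by lifts of the generators of \<open>L\<close> together with
the finitely many generators of the kernel.\<close>

lemma fg_ext_preimage:
  assumes I: "ideal I R" and L: "fg_ext S (h ` I) L"
  shows "fg_ext R I (preimage L)"
proof -
  have IC: "I \<subseteq> carrier R" "h ` I \<subseteq> carrier S"
    using ideal.subset_carrier[OF I] by auto
  have L': "ideal L S" "h ` I \<subseteq> L" using S.fg_extD[OF L IC(2)] by auto
  obtain A where A: "A \<subseteq> carrier S" "finite A" "L = Idl\<^bsub>S\<^esub> (h ` I \<union> A)"
    using L unfolding fg_ext_def by blast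
  obtain A' where A': "A' \<subseteq> carrier R" "finite A'" "A = h ` A'"
    using finite_subset_image[OF A(2), of h "carrier R"] A(1) surj by metis
  obtain B where B: "B \<subseteq> carrier R" "finite B" "a_kernel R S h = Idl B"
    using kernel_fin_gen unfolding fin_gen_ideal_def by blast
  define G where "G = Idl (I \<union> (A' \<union> B))"
  have C: "I \<union> (A' \<union> B) \<subseteq> carrier R" "I \<union> A' \<subseteq> carrier R" using IC A' B by auto
  have G: "ideal G R" "I \<union> (A' \<union> B) \<subseteq> G"
    unfolding G_def using C R.genideal_ideal R.genideal_self by blast+
  have ker: "a_kernel R S h \<subseteq> G"
    unfolding B(3) using G by (intro R.genideal_minimal) auto
  have "L = h ` (Idl (I \<union> A'))"
    unfolding A(3) A'(3) image_genideal[OF C(2)] image_Un ..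
  also have "\<dots> \<subseteq> h ` G"
    unfolding G_def using C by (intro image_mono R.genideal_mono) auto
  finally have "L \<subseteq> h ` G" .
  then have "preimage L \<subseteq> G"
    unfolding preimage_def using ring_hom_ring.mem_ideal_of_image[OF hom_ring G(1) ker] by blast
  moreover have "G \<subseteq> preimage L"
    unfolding G_def
  proof (rule R.genideal_minimal[OF ideal_preimage[OF L'(1)]], intro Un_least)
    show "I \<subseteq> preimage L" unfolding preimage_def using IC L' by blast
    have "h ` I \<union> A \<subseteq> L" unfolding A(3) using IC A(1) by (intro S.genideal_self) simp
    then show "A' \<subseteq> preimage L" unfolding preimage_def using A' by blast
    have "B \<subseteq> a_kernel R S h" unfolding B(3) using B(1) by (rule R.genideal_self)
    then show "B \<subseteq> preimage L"
      unfolding preimage_def a_kernel_def'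
      using additive_subgroup.zero_closed[OF ideal.axioms(1)[OF L'(1)]] by auto
  qed
  ultimately have "preimage L = Idl (I \<union> (A' \<union> B))" unfolding G_def by (rule equalityI)
  then show ?thesis
    unfolding fg_ext_def using A' B by (intro exI[of _ "A' \<union> B"]) simp
qed

text \<open>All bounds on distances in \<open>R\<close> by distances in \<open>S\<close> come from here. Paths in \<open>S\<close> are turned
into peaks first because the preimage of the lower ideal of a valley contains the kernel and thus
need not lie below \<open>I\<close> and \<open>J\<close>.\<close>

lemma peak_lift:
  assumes "I \<in> proper_ideals R" "J \<in> proper_ideals R" "peak S (h ` I) (h ` J)"
  shows "peak R I J"
  using assms fg_ext_preimage preimage_proper R.proper_ideal unfolding peak_def by metis

lemma hops_image:
  assumes "(hop (GF R) ^^ k) I J"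
  shows "(hop (GF S) ^^ k) (h ` I) (h ` J)"
  using assms
proof (induction k arbitrary: I)
  case (Suc k)
  then obtain X where X: "hop (GF R) I X" "(hop (GF R) ^^ k) X J"
    by (meson relpowp_Suc_E2)
  have "hop (GF S) (h ` I) (h ` X)"
    using X(1) image_proper fg_ext_image R.proper_subset_carrier
    unfolding R.hop_GF_iff S.hop_GF_iff by blast
  then show ?case using Suc.IH[OF X(2)] by (rule relpowp_Suc_I2)
qed auto

text \<open>Taking images maps paths of \<open>R\<close> to paths of \<open>S\<close>, and every proper ideal of \<open>S\<close> is the image of
its preimage.\<close>

lemma diam_quotient_le:
  assumes "diam (GF R) \<le> ereal (real k)"
  shows "diam (GF S) \<le> ereal (real k)"
  unfolding diam_GF_le_iff
proof (intro ballI)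
  fix I J assume IJ: "I \<in> proper_ideals S" "J \<in> proper_ideals S"
  then have "(hop (GF R) ^^ k) (preimage I) (preimage J)"
    using assms preimage_proper unfolding diam_GF_le_iff by blast
  then have "(hop (GF S) ^^ k) (h ` preimage I) (h ` preimage J)"
    by (rule hops_image)
  then show "(hop (GF S) ^^ k) I J"
    by (simp add: image_preimage S.proper_ideal IJ)
qed

text \<open>Comaximal ideals are always at distance at most 2; for all others the path of length 2 between
their images is a peak or can be replaced by one, and peaks lift.\<close>

lemma diam_lift_le_2:
  assumes "diam (GF S) \<le> ereal (real 2)"
  shows "diam (GF R) \<le> ereal (real 2)"
  unfolding diam_GF_le_iff
proof (intro ballI)
  fix I J assume P: "I \<in> proper_ideals R" "J \<in> proper_ideals R"
  show "(hop (GF R) ^^ 2) I J"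
  proof (cases "comaximal R I J")
    case True
    then show ?thesis using P by (intro R.comaximal_hops)
  next
    case False
    then have no: "\<not> comaximal S (h ` I) (h ` J)"
      using P R.proper_ideal comaximal_image_iff by blast
    have "(hop (GF S) ^^ 2) (h ` I) (h ` J)"
      using assms P image_proper unfolding diam_GF_le_iff by blast
    then have "peak S (h ` I) (h ` J)"
      using no S.peak_of_two_hops by (auto simp: numeral_2_eq_2)
    then show ?thesis using P by (intro R.peak_hops peak_lift)
  qed
qed

text \<open>Ideals that are separated by comaximality are always at distance at most 3; for all others
the images are not separated either, so that the path of length 3 collapses to a peak.\<close>

lemma diam_lift_le_3:
  assumes "diam (GF S) \<le> ereal (real 3)"
  shows "diam (GF R) \<le> ereal (real 3)"
  unfolding diam_GF_le_iff
proof (intro ballI)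
  fix I J assume P: "I \<in> proper_ideals R" "J \<in> proper_ideals R"
  show "(hop (GF R) ^^ 3) I J"
  proof (cases "\<exists>L. ideal L R \<and> comaximal R I L \<noteq> comaximal R J L")
    case True
    then show ?thesis using P R.three_hops_of_separated by blast
  next
    case False
    have "comaximal S (h ` I) L \<longleftrightarrow> comaximal S (h ` J) L" if "ideal L S" for L
      using False ideal_preimage[OF that] by (simp add: comaximal_image_left_iff that P R.proper_ideal)
    moreover have "(hop (GF S) ^^ 3) (h ` I) (h ` J)"
      using assms P image_proper unfolding diam_GF_le_iff by blast
    ultimately have "peak S (h ` I) (h ` J)" by (intro S.peak_of_three_hops)
    then have "(hop (GF R) ^^ 2) I J" using P by (intro R.peak_hops peak_lift)
    then show ?thesis by (rule hop_pow_mono) (use P in auto)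
  qed
qed

text \<open>A nonlocal ring always has diameter at most 4, and \<open>R\<close> is nonlocal if \<open>S\<close> is. If \<open>S\<close> is local,
all paths in it collapse to peaks.\<close>

lemma diam_lift_le_4:
  assumes "diam (GF S) \<le> ereal (real 4)"
  shows "diam (GF R) \<le> ereal (real 4)"
  unfolding diam_GF_le_iff
proof (intro ballI)
  fix I J assume P: "I \<in> proper_ideals R" "J \<in> proper_ideals R"
  show "(hop (GF R) ^^ 4) I J"
  proof (cases "\<exists>N\<in>proper_ideals S. \<exists>N'\<in>proper_ideals S. comaximal S N N'")
    case True
    then obtain N N' where N: "N \<in> proper_ideals S" "N' \<in> proper_ideals S" "comaximal S N N'"
      by blast
    then have "comaximal R (preimage N) (preimage N')"
      by (simp add: ideal_preimage image_preimage S.proper_ideal flip: comaximal_image_left_iff)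
    then show ?thesis
      using N P by (intro R.four_hops_of_nonlocal[of "preimage N" "preimage N'"] preimage_proper)
  next
    case False
    have "(hop (GF S) ^^ 4) (h ` I) (h ` J)"
      using assms P image_proper unfolding diam_GF_le_iff by blast
    then have "peak S (h ` I) (h ` J)"
      using False image_proper P by (intro S.peak_of_hops_local[of 4]) blast+
    then have "(hop (GF R) ^^ 2) I J" using P by (intro R.peak_hops peak_lift)
    then show ?thesis by (rule hop_pow_mono) (use P in auto)
  qed
qed

end

section \<open>The ring of formal power series\<close>

text \<open>The index set of the Cauchy product at the exponent \<open>e\<close>.\<close>

definition splits :: "nat \<Rightarrow> (nat \<Rightarrow> nat) \<Rightarrow> ((nat \<Rightarrow> nat) \<times> (nat \<Rightarrow> nat)) set" where
  "splits m e = {(a, b) \<in> exponents m \<times> exponents m. (\<lambda>i. a i + b i) = e}"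

definition degree :: "nat \<Rightarrow> (nat \<Rightarrow> nat) \<Rightarrow> nat" where
  "degree m e = (\<Sum>i=1..m. e i)"

definition unit_exponent :: "nat \<Rightarrow> nat \<Rightarrow> nat" where
  "unit_exponent i = (\<lambda>j. if j = i then 1 else 0)"

lemma zero_exponent [simp]: "(\<lambda>i. 0) \<in> exponents m"
  by (simp add: exponents_def)

lemma add_exponents: "a \<in> exponents m \<Longrightarrow> b \<in> exponents m \<Longrightarrow> (\<lambda>i. a i + b i) \<in> exponents m"
  by (simp add: exponents_def)

lemma diff_exponents: "a \<in> exponents m \<Longrightarrow> (\<lambda>i. a i - b i) \<in> exponents m"
  by (simp add: exponents_def)

lemma unit_exponent_in: "i \<in> {1..m} \<Longrightarrow> unit_exponent i \<in> exponents m"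
  by (auto simp: exponents_def unit_exponent_def)

lemma splits_iff:
  "p \<in> splits m e \<longleftrightarrow>
     fst p \<in> exponents m \<and> snd p \<in> exponents m \<and> (\<lambda>i. fst p i + snd p i) = e"
  by (auto simp: splits_def)

lemma splitsD:
  assumes "p \<in> splits m e"
  shows "fst p \<in> exponents m" "snd p \<in> exponents m" "(\<lambda>i. fst p i + snd p i) = e"
  using assms by (simp_all add: splits_iff)

lemma finite_splits: "finite (splits m e)"
proof -
  let ?D = "{a. \<forall>i. (i \<in> {1..m} \<longrightarrow> a i \<in> {..(\<Sum>i=1..m. e i)}) \<and> (i \<notin> {1..m} \<longrightarrow> a i = 0)}"
  have fin: "finite ?D" by (rule finite_set_of_finite_funs) auto
  have bound: "a i \<le> (\<Sum>i=1..m. e i)" if "a i \<le> e i" "i \<in> {1..m}" for a :: "nat \<Rightarrow> nat" and i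
    using that member_le_sum[of i "{1..m}" e] by (meson finite_atLeastAtMost le_trans zero_le)
  have "splits m e \<subseteq> ?D \<times> ?D"
  proof
    fix p assume p: "p \<in> splits m e"
    have "fst p i \<le> e i" "snd p i \<le> e i" for i
      using fun_cong[OF splitsD(3)[OF p], of i] by simp_all
    then show "p \<in> ?D \<times> ?D"
      using splitsD(1,2)[OF p] bound unfolding mem_Times_iff exponents_def by simp
  qed
  then show ?thesis using fin by (meson finite_SigmaI finite_subset)
qed

lemma splits_swap: "prod.swap ` splits m e = splits m e"
proof -
  have "prod.swap p \<in> splits m e" if "p \<in> splits m e" for p
    using that by (simp add: splits_iff add.commute)
  then show ?thesis by (metis (no_types, lifting) image_subsetI subset_antisym image_eqI subsetI swap_swap)
qed

lemma splits_zero: "splits m (\<lambda>i. 0) = {(\<lambda>i. 0, \<lambda>i. 0)}"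
  by (auto simp: splits_def fun_eq_iff)

lemma degree_snd_less:
  assumes "p \<in> splits m e" "fst p \<noteq> (\<lambda>i. 0)"
  shows "degree m (snd p) < degree m e"
proof -
  have "\<exists>i. fst p i \<noteq> 0" using assms(2) by (simp add: fun_eq_iff)
  then obtain i where i: "fst p i \<noteq> 0" by blast
  then have "i \<in> {1..m}"
    using splitsD(1)[OF assms(1)] by (rule_tac ccontr) (simp add: exponents_def)
  moreover have e: "e j = fst p j + snd p j" for j
    using fun_cong[OF splitsD(3)[OF assms(1)], of j] by simp
  ultimately show ?thesis
    unfolding degree_def using i by (intro sum_strict_mono_ex1) (auto simp: e)
qed

text \<open>Iterated sums are compared below by flattening them, which permits reindexing.\<close>

lemma (in abelian_monoid) finsum_Sigma:
  assumes "finite A" "\<And>i. i \<in> A \<Longrightarrow> finite (B i)"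
    and F: "\<And>i j. i \<in> A \<Longrightarrow> j \<in> B i \<Longrightarrow> F (i, j) \<in> carrier G"
  shows "(\<Oplus>i\<in>A. \<Oplus>j\<in>B i. F (i, j)) = (\<Oplus>p\<in>Sigma A B. F p)"
proof -
  have "(\<Oplus>p\<in>Sigma A B. F p) = (\<Oplus>p\<in>(\<Union>i\<in>A. Pair i ` B i). F p)"
    by (rule arg_cong[of _ _ "finsum G F"]) auto
  also have "\<dots> = (\<Oplus>i\<in>A. finsum G F (Pair i ` B i))"
    using assms by (intro add.finprod_UN_disjoint) (auto simp: pairwise_def disjnt_def)
  also have "\<dots> = (\<Oplus>i\<in>A. \<Oplus>j\<in>B i. F (i, j))"
  proof (intro finsum_cong' refl)
    show "finsum G F (Pair i ` B i) = (\<Oplus>j\<in>B i. F (i, j))" if "i \<in> A" for i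
      using F[OF that] by (intro finsum_reindex) (auto simp: inj_on_def)
  qed (use F in \<open>auto intro!: finsum_closed\<close>)
  finally show ?thesis by simp
qed

locale power_series = cring +
  fixes m :: nat
begin

abbreviation E :: "(nat \<Rightarrow> nat) set" where
  "E \<equiv> exponents m"

abbreviation P :: "((nat \<Rightarrow> nat) \<Rightarrow> 'a) ring" where
  "P \<equiv> power_series_ring R m"

definition monom :: "'a \<Rightarrow> (nat \<Rightarrow> nat) \<Rightarrow> (nat \<Rightarrow> nat) \<Rightarrow> 'a" where
  "monom c d = (\<lambda>e\<in>E. if e = d then c else \<zero>)"

lemma carrier_P: "carrier P = E \<rightarrow>\<^sub>E carrier R"
  by (simp add: power_series_ring_def)

lemma coeff_closed: "f \<in> carrier P \<Longrightarrow> e \<in> E \<Longrightarrow> f e \<in> carrier R"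
  by (auto simp: carrier_P)

lemma restrict_in_P: "(\<And>e. e \<in> E \<Longrightarrow> F e \<in> carrier R) \<Longrightarrow> (\<lambda>e\<in>E. F e) \<in> carrier P"
  by (auto simp: carrier_P)

lemma series_eqI:
  assumes "f \<in> carrier P" "g \<in> carrier P" "\<And>e. e \<in> E \<Longrightarrow> f e = g e"
  shows "f = g"
  using assms unfolding carrier_P by (intro PiE_ext)

lemma coeff_add: "e \<in> E \<Longrightarrow> (f \<oplus>\<^bsub>P\<^esub> g) e = f e \<oplus> g e"
  and coeff_zero: "e \<in> E \<Longrightarrow> \<zero>\<^bsub>P\<^esub> e = \<zero>"
  and coeff_mult: "e \<in> E \<Longrightarrow> (f \<otimes>\<^bsub>P\<^esub> g) e = (\<Oplus>p\<in>splits m e. f (fst p) \<otimes> g (snd p))"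
  by (simp_all add: power_series_ring_def splits_def)

lemma mult_eq: "f \<otimes>\<^bsub>P\<^esub> g = (\<lambda>e\<in>E. \<Oplus>p\<in>splits m e. f (fst p) \<otimes> g (snd p))"
  by (simp add: power_series_ring_def splits_def)

lemma one_eq_monom: "\<one>\<^bsub>P\<^esub> = monom \<one> (\<lambda>i. 0)"
  by (simp add: power_series_ring_def monom_def)

lemma product_terms_closed:
  assumes "f \<in> carrier P" "g \<in> carrier P"
  shows "(\<lambda>p. f (fst p) \<otimes> g (snd p)) \<in> splits m e \<rightarrow> carrier R"
proof (intro Pi_I m_closed)
  fix p assume p: "p \<in> splits m e"
  show "f (fst p) \<in> carrier R" using assms(1) splitsD(1)[OF p] by (rule coeff_closed)
  show "g (snd p) \<in> carrier R" using assms(2) splitsD(2)[OF p] by (rule coeff_closed)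
qed

lemma add_closed: "f \<in> carrier P \<Longrightarrow> g \<in> carrier P \<Longrightarrow> f \<oplus>\<^bsub>P\<^esub> g \<in> carrier P"
  using coeff_closed[of f] coeff_closed[of g] by (simp add: carrier_P) (simp add: power_series_ring_def)

lemma mult_closed: "f \<in> carrier P \<Longrightarrow> g \<in> carrier P \<Longrightarrow> f \<otimes>\<^bsub>P\<^esub> g \<in> carrier P"
  unfolding mult_eq by (intro restrict_in_P finsum_closed product_terms_closed)

lemma zero_closed': "\<zero>\<^bsub>P\<^esub> \<in> carrier P"
  by (auto simp: power_series_ring_def)

lemma monom_closed: "c \<in> carrier R \<Longrightarrow> monom c d \<in> carrier P"
  unfolding monom_def by (intro restrict_in_P) simp

lemma coeff_monom_mult:
  assumes f: "f \<in> carrier P" and c: "c \<in> carrier R" and d: "d \<in> E" and e: "e \<in> E"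
  shows "(monom c d \<otimes>\<^bsub>P\<^esub> f) e = (if \<forall>i. d i \<le> e i then c \<otimes> f (\<lambda>i. e i - d i) else \<zero>)"
proof -
  let ?F = "\<lambda>p. monom c d (fst p) \<otimes> f (snd p)"
  let ?q = "(d, \<lambda>i. e i - d i)"
  have Pi: "?F \<in> splits m e \<rightarrow> carrier R" by (intro product_terms_closed monom_closed c f)
  have only: "p = ?q \<and> (\<forall>i. d i \<le> e i)" if p: "p \<in> splits m e" and nz: "?F p \<noteq> \<zero>" for p
  proof -
    have "f (snd p) \<in> carrier R" using f splitsD(2)[OF p] by (rule coeff_closed)
    then have fst: "fst p = d"
      using nz splitsD(1)[OF p] by (auto simp: monom_def split: if_splits)
    have "e i = d i + snd p i" for i
      using splitsD(3)[OF p] fst by (auto simp: fun_eq_iff)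
    then show ?thesis using fst by (auto simp: prod_eq_iff)
  qed
  show ?thesis
  proof (cases "\<forall>i. d i \<le> e i")
    case True
    have q: "?q \<in> splits m e" using True d e by (auto simp: splits_iff diff_exponents)
    have "(\<Oplus>p\<in>splits m e. ?F p) = (\<Oplus>p\<in>{?q}. ?F p)"
    proof (rule add.finprod_mono_neutral_cong_right[OF finite_splits _ _ refl Pi])
      show "{?q} \<subseteq> splits m e" using q by simp
      show "?F p = \<zero>" if "p \<in> splits m e - {?q}" for p
        using only[of p] that by blast
    qed
    also have "\<dots> = ?F ?q"
    proof -
      have "?F ?q \<in> carrier R" using Pi q by (rule Pi_mem)
      then show ?thesis by (subst finsum_insert) (simp_all add: finsum_empty)
    qed
    finally show ?thesis using True d e by (simp add: coeff_mult monom_def)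
  next
    case False
    then have "(\<Oplus>p\<in>splits m e. ?F p) = \<zero>"
      using only by (intro add.finprod_one_eqI) blast
    then show ?thesis unfolding coeff_mult[OF e] if_not_P[OF False] .
  qed
qed

lemma mult_commute: 
  assumes "f \<in> carrier P" "g \<in> carrier P"
  shows "f \<otimes>\<^bsub>P\<^esub> g = g \<otimes>\<^bsub>P\<^esub> f"
proof (rule series_eqI)
  fix e assume e: "e \<in> E"
  have swapped: "(\<lambda>p. f (fst p) \<otimes> g (snd p)) \<in> prod.swap ` splits m e \<rightarrow> carrier R"
    unfolding splits_swap using assms by (rule product_terms_closed)
  have "(f \<otimes>\<^bsub>P\<^esub> g) e = (\<Oplus>p\<in>prod.swap ` splits m e. f (fst p) \<otimes> g (snd p))"
    unfolding splits_swap using e by (rule coeff_mult)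
  also have "\<dots> = (\<Oplus>p\<in>splits m e. f (fst (prod.swap p)) \<otimes> g (snd (prod.swap p)))"
    using swapped by (rule finsum_reindex) simp
  also have "\<dots> = (\<Oplus>p\<in>splits m e. g (fst p) \<otimes> f (snd p))"
  proof (rule finsum_cong'[OF refl product_terms_closed[OF assms(2,1)]])
    fix p assume p: "p \<in> splits m e"
    show "f (fst (prod.swap p)) \<otimes> g (snd (prod.swap p)) = g (fst p) \<otimes> f (snd p)"
      using coeff_closed[OF assms(1) splitsD(2)[OF p]] coeff_closed[OF assms(2) splitsD(1)[OF p]]
      by (simp add: m_comm)
  qed
  finally show "(f \<otimes>\<^bsub>P\<^esub> g) e = (g \<otimes>\<^bsub>P\<^esub> f) e"
    unfolding coeff_mult[OF e] .
qed (use assms mult_closed in auto)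

lemma mult_assoc:
  assumes f: "f \<in> carrier P" and g: "g \<in> carrier P" and h: "h \<in> carrier P"
  shows "(f \<otimes>\<^bsub>P\<^esub> g) \<otimes>\<^bsub>P\<^esub> h = f \<otimes>\<^bsub>P\<^esub> (g \<otimes>\<^bsub>P\<^esub> h)"
proof (rule series_eqI)
  fix e assume e: "e \<in> E"
  \<comment> \<open>Both sides are sums over the decompositions \<open>e = a + b + c\<close>, encoded once as
    \<open>((a + b, c), (a, b))\<close> and once as \<open>((a, b + c), (b, c))\<close>; \<open>?\<psi>\<close> and \<open>?\<phi>\<close> translate.\<close>
  let ?L = "\<lambda>(p, q). f (fst q) \<otimes> g (snd q) \<otimes> h (snd p)"
  let ?R = "\<lambda>(p, q). f (fst p) \<otimes> (g (fst q) \<otimes> h (snd q))"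
  let ?SL = "Sigma (splits m e) (\<lambda>p. splits m (fst p))"
  let ?SR = "Sigma (splits m e) (\<lambda>p. splits m (snd p))"
  let ?\<psi> = "\<lambda>(p, q). (((\<lambda>i. fst p i + fst q i), snd q), (fst p, fst q))"
  let ?\<phi> = "\<lambda>(p, q). ((fst q, (\<lambda>i. snd q i + snd p i)), (snd q, snd p))"
  note [simp] = coeff_closed[OF f] coeff_closed[OF g] coeff_closed[OF h]
  have closed: "?L x \<in> carrier R" if "x \<in> ?SL" for x
    using that by (auto simp: splits_iff intro!: m_closed)
  have closed': "?R x \<in> carrier R" if "x \<in> ?SR" for x
    using that by (auto simp: splits_iff intro!: m_closed)
  have "((f \<otimes>\<^bsub>P\<^esub> g) \<otimes>\<^bsub>P\<^esub> h) e =
        (\<Oplus>p\<in>splits m e. (\<Oplus>q\<in>splits m (fst p). f (fst q) \<otimes> g (snd q)) \<otimes> h (snd p))"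
    using e product_terms_closed[OF f g] product_terms_closed[OF mult_closed[OF f g] h]
    by (auto simp: coeff_mult splits_iff intro!: finsum_cong' m_closed finsum_closed)
  also have "\<dots> = (\<Oplus>p\<in>splits m e. \<Oplus>q\<in>splits m (fst p). ?L (p, q))"
    using product_terms_closed[OF f g]
    by (intro finsum_cong') (auto simp: splits_iff finite_splits intro!: finsum_ldistr finsum_closed)
  also have "\<dots> = finsum R ?L ?SL"
    using closed by (intro finsum_Sigma finite_splits) auto
  also have "\<dots> = finsum R ?L (?\<psi> ` ?SR)"
  proof (rule arg_cong[of _ _ "finsum R ?L"])
    have "?\<psi> ` ?SR \<subseteq> ?SL"
      by (auto simp: splits_iff fun_eq_iff add_exponents add.assoc)
    moreover have "x \<in> ?\<psi> ` ?SR" if x: "x \<in> ?SL" for x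
    proof -
      have x': "?\<phi> x \<in> ?SR" "x = ?\<psi> (?\<phi> x)"
        using x by (auto simp: splits_iff fun_eq_iff add_exponents prod_eq_iff)
          (metis add.assoc)
      show ?thesis using x'(2,1) by (rule image_eqI)
    qed
    ultimately show "?SL = ?\<psi> ` ?SR" by blast
  qed
  also have "\<dots> = (\<Oplus>x\<in>?SR. ?L (?\<psi> x))"
  proof (rule finsum_reindex)
    show "inj_on ?\<psi> ?SR"
      by (auto simp: inj_on_def splits_iff prod_eq_iff)
    show "?L \<in> ?\<psi> ` ?SR \<rightarrow> carrier R"
      by (auto simp: splits_iff intro!: m_closed)
  qed
  also have "\<dots> = finsum R ?R ?SR"
    using closed' by (intro finsum_cong') (auto simp: splits_iff m_assoc)
  also have "\<dots> = (\<Oplus>p\<in>splits m e. \<Oplus>q\<in>splits m (snd p). ?R (p, q))"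
    using closed' by (intro finsum_Sigma[symmetric] finite_splits) auto
  also have "\<dots> = (\<Oplus>p\<in>splits m e. f (fst p) \<otimes> (\<Oplus>q\<in>splits m (snd p). g (fst q) \<otimes> h (snd q)))"
    using product_terms_closed[OF g h]
    by (intro finsum_cong')
      (auto simp: splits_iff finite_splits intro!: finsum_rdistr[symmetric] m_closed finsum_closed)
  also have "\<dots> = (f \<otimes>\<^bsub>P\<^esub> (g \<otimes>\<^bsub>P\<^esub> h)) e"
    using e product_terms_closed[OF g h] product_terms_closed[OF f mult_closed[OF g h]]
    by (auto simp: coeff_mult splits_iff intro!: finsum_cong' m_closed finsum_closed)
  finally show "((f \<otimes>\<^bsub>P\<^esub> g) \<otimes>\<^bsub>P\<^esub> h) e = (f \<otimes>\<^bsub>P\<^esub> (g \<otimes>\<^bsub>P\<^esub> h)) e" .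
qed (use assms mult_closed in auto)

lemma power_series_cring: "cring P"
proof (rule cringI)
  show "abelian_group P"
  proof (rule abelian_groupI)
    fix f assume f: "f \<in> carrier P"
    show "\<exists>g\<in>carrier P. g \<oplus>\<^bsub>P\<^esub> f = \<zero>\<^bsub>P\<^esub>"
    proof (rule bexI)
      show c: "(\<lambda>e\<in>E. \<ominus> f e) \<in> carrier P" using f coeff_closed by (intro restrict_in_P) simp
      show "(\<lambda>e\<in>E. \<ominus> f e) \<oplus>\<^bsub>P\<^esub> f = \<zero>\<^bsub>P\<^esub>"
        using f coeff_closed[OF f]
        by (intro series_eqI add_closed c zero_closed') (simp_all add: coeff_add coeff_zero l_neg)
    qed
  next
    fix f g h assume "f \<in> carrier P" "g \<in> carrier P" "h \<in> carrier P"
    then show "f \<oplus>\<^bsub>P\<^esub> g \<oplus>\<^bsub>P\<^esub> h = f \<oplus>\<^bsub>P\<^esub> (g \<oplus>\<^bsub>P\<^esub> h)"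
      by (intro series_eqI add_closed) (simp_all add: coeff_add coeff_closed a_assoc)
  next
    fix f g assume "f \<in> carrier P" "g \<in> carrier P"
    then show "f \<oplus>\<^bsub>P\<^esub> g = g \<oplus>\<^bsub>P\<^esub> f"
      by (intro series_eqI add_closed) (simp_all add: coeff_add coeff_closed a_comm)
  next
    fix f assume "f \<in> carrier P"
    then show "\<zero>\<^bsub>P\<^esub> \<oplus>\<^bsub>P\<^esub> f = f"
      by (intro series_eqI add_closed zero_closed') (simp_all add: coeff_add coeff_zero coeff_closed)
  qed (simp_all add: add_closed zero_closed')
  show "comm_monoid P"
  proof (rule comm_monoidI)
    show "\<one>\<^bsub>P\<^esub> \<in> carrier P" unfolding one_eq_monom by (intro monom_closed) simp
  next
    fix f assume f: "f \<in> carrier P"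
    show "\<one>\<^bsub>P\<^esub> \<otimes>\<^bsub>P\<^esub> f = f"
      unfolding one_eq_monom using f
      by (intro series_eqI mult_closed monom_closed)
        (simp_all add: coeff_monom_mult coeff_closed)
  next
    fix f g assume "f \<in> carrier P" "g \<in> carrier P"
    then show "f \<otimes>\<^bsub>P\<^esub> g = g \<otimes>\<^bsub>P\<^esub> f" by (rule mult_commute)
  qed (simp_all add: mult_closed mult_assoc)
next
  fix f g h assume fgh: "f \<in> carrier P" "g \<in> carrier P" "h \<in> carrier P"
  show "(f \<oplus>\<^bsub>P\<^esub> g) \<otimes>\<^bsub>P\<^esub> h = f \<otimes>\<^bsub>P\<^esub> h \<oplus>\<^bsub>P\<^esub> g \<otimes>\<^bsub>P\<^esub> h"
  proof (rule series_eqI)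
    fix e assume e: "e \<in> E"
    have "((f \<oplus>\<^bsub>P\<^esub> g) \<otimes>\<^bsub>P\<^esub> h) e =
          (\<Oplus>p\<in>splits m e. f (fst p) \<otimes> h (snd p) \<oplus> g (fst p) \<otimes> h (snd p))"
      unfolding coeff_mult[OF e] using fgh
      by (intro finsum_cong') (auto simp: splits_iff coeff_add coeff_closed l_distr)
    then show "((f \<oplus>\<^bsub>P\<^esub> g) \<otimes>\<^bsub>P\<^esub> h) e = (f \<otimes>\<^bsub>P\<^esub> h \<oplus>\<^bsub>P\<^esub> g \<otimes>\<^bsub>P\<^esub> h) e"
      using e product_terms_closed[OF fgh(1,3)] product_terms_closed[OF fgh(2,3)]
      by (simp add: coeff_add coeff_mult finsum_addf)
  qed (use fgh in \<open>simp_all add: add_closed mult_closed\<close>)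
qed

section \<open>Power series as a lift of the coefficient ring\<close>

sublocale P: cring P
  by (rule power_series_cring)

abbreviation const_coeff :: "((nat \<Rightarrow> nat) \<Rightarrow> 'a) \<Rightarrow> 'a" where
  "const_coeff f \<equiv> f (\<lambda>i. 0)"

abbreviation X :: "nat \<Rightarrow> (nat \<Rightarrow> nat) \<Rightarrow> 'a" where
  "X i \<equiv> monom \<one> (unit_exponent i)"

lemma const_coeff_mult:
  assumes "f \<in> carrier P" "g \<in> carrier P"
  shows "const_coeff (f \<otimes>\<^bsub>P\<^esub> g) = const_coeff f \<otimes> const_coeff g"
proof -
  have "const_coeff f \<otimes> const_coeff g \<in> carrier R"
    using coeff_closed[OF assms(1)] coeff_closed[OF assms(2)] by simp
  then show ?thesis
    unfolding coeff_mult[OF zero_exponent] splits_zero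
    by (subst finsum_insert) (simp_all add: finsum_empty)
qed

lemma const_coeff_hom: "ring_hom_cring P R const_coeff"
proof (intro ring_hom_cring.intro ring_hom_cring_axioms.intro ring_hom_memI)
  show "const_coeff \<one>\<^bsub>P\<^esub> = \<one>" by (simp add: one_eq_monom monom_def)
qed (simp_all add: P.is_cring is_cring coeff_closed const_coeff_mult coeff_add)

text \<open>The equation \<open>f g = 1\<close> with \<open>f(0) = 1\<close> determines \<open>g(e)\<close> from the values of \<open>g\<close> at exponents of
smaller degree. The coefficients are therefore obtained by recursion on the degree.\<close>

lemma right_inverse:
  assumes f: "f \<in> carrier P" and f0: "const_coeff f = \<one>"
  shows "\<exists>g\<in>carrier P. f \<otimes>\<^bsub>P\<^esub> g = \<one>\<^bsub>P\<^esub>"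
proof -
  define S where "S e = splits m e - {(\<lambda>i. 0, e)}" for e
  \<comment> \<open>Outside \<open>S e\<close> the summand is left undefined, so that it depends on \<open>g\<close> only through exponents
    of degree smaller than that of \<open>e\<close>, even for a \<open>g\<close> with values outside the carrier.\<close>
  define F where "F g e = (\<lambda>p\<in>S e. f (fst p) \<otimes> g (snd p))" for g :: "(nat \<Rightarrow> nat) \<Rightarrow> 'a" and e
  define \<delta> where "\<delta> e = (if e = (\<lambda>i. 0) then \<one> else \<zero>)" for e :: "nat \<Rightarrow> nat"
  define Q where "Q g e r \<longleftrightarrow> r \<in> carrier R \<and> r = \<delta> e \<ominus> finsum R (F g e) (S e)" for g e r
  have less: "(snd p, e) \<in> measure (degree m)" if p: "p \<in> S e" for p e
  proof -
    have "fst p \<noteq> (\<lambda>i. 0)"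
    proof
      assume z: "fst p = (\<lambda>i. 0)"
      then have "snd p = e" using p splitsD(3)[of p m e] by (simp add: S_def)
      then show False using p z by (simp add: S_def prod_eq_iff)
    qed
    then show ?thesis using p degree_snd_less[of p m e] by (simp add: S_def)
  qed
  have fin: "finite (S e)" for e by (simp add: S_def finite_splits)
  have fC: "f (fst p) \<in> carrier R" if "p \<in> S e" for p e
    using that splitsD(1)[of p m e] by (intro coeff_closed[OF f]) (simp add: S_def)
  have \<delta>C: "\<delta> e \<in> carrier R" for e by (simp add: \<delta>_def)
  have FC: "F g e \<in> S e \<rightarrow> carrier R" if "\<And>p. p \<in> S e \<Longrightarrow> g (snd p) \<in> carrier R" for g e
    using that fC by (simp add: F_def Pi_iff)
  have "\<exists>g. \<forall>e. Q g e (g e)"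
  proof (rule dependent_wf_choice[OF wf_measure[of "degree m"]])
    fix g g' :: "(nat \<Rightarrow> nat) \<Rightarrow> 'a" and e r
    assume "\<And>z. (z, e) \<in> measure (degree m) \<Longrightarrow> g z = g' z"
    then have "F g e = F g' e" unfolding F_def using less by (intro restrict_ext) metis
    then show "Q g e r = Q g' e r" by (simp add: Q_def)
  next
    fix g :: "(nat \<Rightarrow> nat) \<Rightarrow> 'a" and e
    assume "\<And>y. (y, e) \<in> measure (degree m) \<Longrightarrow> Q g y (g y)"
    then have "F g e \<in> S e \<rightarrow> carrier R" using less by (intro FC) (metis Q_def)
    then have "finsum R (F g e) (S e) \<in> carrier R" by (rule finsum_closed)
    then show "\<exists>r. Q g e r" unfolding Q_def using \<delta>C by blast
  qed
  then obtain g where Q: "\<And>e. Q g e (g e)" by blast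
  have gC: "g e \<in> carrier R" for e using Q[of e] unfolding Q_def by (rule conjunct1)
  define G where "G = (\<lambda>e\<in>E. g e)"
  have G: "G \<in> carrier P" unfolding G_def using gC by (intro restrict_in_P)
  have "f \<otimes>\<^bsub>P\<^esub> G = \<one>\<^bsub>P\<^esub>"
  proof (rule series_eqI)
    fix e assume e: "e \<in> E"
    have ins: "splits m e = insert (\<lambda>i. 0, e) (S e)" "(\<lambda>i. 0, e) \<notin> S e"
      using e by (auto simp: S_def splits_iff)
    have sum: "finsum R (F g e) (S e) \<in> carrier R" using FC gC by (intro finsum_closed) simp
    have "(f \<otimes>\<^bsub>P\<^esub> G) e = (\<Oplus>p\<in>insert (\<lambda>i. 0, e) (S e). f (fst p) \<otimes> G (snd p))"
      using e by (simp add: coeff_mult ins(1))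
    also have "\<dots> = const_coeff f \<otimes> G e \<oplus> (\<Oplus>p\<in>S e. f (fst p) \<otimes> G (snd p))"
      using product_terms_closed[OF f G, of e] ins fin
      by (subst finsum_insert) (simp_all add: Pi_iff)
    also have "(\<Oplus>p\<in>S e. f (fst p) \<otimes> G (snd p)) = finsum R (F g e) (S e)"
    proof (rule finsum_cong'[OF refl])
      show "F g e \<in> S e \<rightarrow> carrier R" using FC gC by simp
      show "f (fst p) \<otimes> G (snd p) = F g e p" if "p \<in> S e" for p
        using that splitsD(2)[of p m e] by (simp add: F_def G_def S_def)
    qed
    also have "const_coeff f \<otimes> G e = g e" using e gC by (simp add: f0 G_def)
    also have "g e = \<delta> e \<ominus> finsum R (F g e) (S e)" using Q[of e] by (simp add: Q_def)
    also have "(\<delta> e \<ominus> finsum R (F g e) (S e)) \<oplus> finsum R (F g e) (S e) = \<delta> e"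
      unfolding minus_eq using \<delta>C[of e] sum by (simp add: a_assoc l_neg)
    finally show "(f \<otimes>\<^bsub>P\<^esub> G) e = \<one>\<^bsub>P\<^esub> e"
      using e by (simp add: \<delta>_def one_eq_monom monom_def)
  qed (use f G in simp_all)
  then show ?thesis using G by blast
qed

lemma X_closed: "X i \<in> carrier P"
  by (intro monom_closed) simp

text \<open>Split \<open>f\<close> into the part whose exponents involve none of the first \<open>k\<close> variables, which is
divisible by the next variable, and the remaining part, to which the induction hypothesis
applies.\<close>

lemma ideal_of_variables:
  assumes "f \<in> carrier P" "k \<le> m"
    and "\<And>e. e \<in> E \<Longrightarrow> \<forall>i\<in>{1..k}. e i = 0 \<Longrightarrow> f e = \<zero>"
  shows "f \<in> Idl\<^bsub>P\<^esub> (X ` {1..m})"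
proof -
  have sub: "X ` {1..m} \<subseteq> carrier P" using X_closed by blast
  interpret G: ideal "Idl\<^bsub>P\<^esub> (X ` {1..m})" P
    using sub by (rule P.genideal_ideal)
  show ?thesis
    using assms
  proof (induction k arbitrary: f)
    case 0
    then have "f = \<zero>\<^bsub>P\<^esub>" by (intro series_eqI) (simp_all add: coeff_zero)
    then show ?case using G.zero_closed by simp
  next
    case (Suc k)
    let ?d = "unit_exponent (Suc k)"
    let ?low = "\<lambda>e. \<forall>i\<in>{1..k}. e i = 0"
    define g where "g = (\<lambda>e\<in>E. if ?low e then \<zero> else f e)"
    define h where "h = (\<lambda>e\<in>E. if ?low e then f (\<lambda>i. e i + ?d i) else \<zero>)"
    have d: "?d \<in> E" using Suc.prems(2) by (intro unit_exponent_in) simp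
    have g: "g \<in> carrier P"
      unfolding g_def using coeff_closed[OF Suc.prems(1)] by (intro restrict_in_P) simp
    have h: "h \<in> carrier P"
      unfolding h_def using coeff_closed[OF Suc.prems(1)] add_exponents d
      by (intro restrict_in_P) simp
    have "g \<in> Idl\<^bsub>P\<^esub> (X ` {1..m})"
    proof (rule Suc.IH[OF g])
      show "k \<le> m" using Suc.prems(2) by simp
      show "g e = \<zero>" if "e \<in> E" "?low e" for e
        unfolding g_def restrict_apply using that by simp
    qed
    moreover have "X (Suc k) \<in> Idl\<^bsub>P\<^esub> (X ` {1..m})"
      using P.genideal_self[OF sub] Suc.prems(2) by auto
    ultimately have "X (Suc k) \<otimes>\<^bsub>P\<^esub> h \<oplus>\<^bsub>P\<^esub> g \<in> Idl\<^bsub>P\<^esub> (X ` {1..m})"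
      using h by (intro G.a_closed G.I_r_closed)
    moreover have "f = X (Suc k) \<otimes>\<^bsub>P\<^esub> h \<oplus>\<^bsub>P\<^esub> g"
    proof (rule series_eqI)
      fix e assume e: "e \<in> E"
      have fe: "f e \<in> carrier R" using Suc.prems(1) e by (rule coeff_closed)
      have le: "(\<forall>i. ?d i \<le> e i) \<longleftrightarrow> e (Suc k) > 0"
        by (auto simp: unit_exponent_def)
      have shift: "(\<lambda>i. e i - ?d i + ?d i) = e" if "e (Suc k) > 0"
        using that by (auto simp: unit_exponent_def fun_eq_iff)
      have low: "?low (\<lambda>i. e i - ?d i) \<longleftrightarrow> ?low e"
        by (auto simp: unit_exponent_def)
      have he: "h (\<lambda>i. e i - ?d i) = (if ?low e then f e else \<zero>)" if "e (Suc k) > 0"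
        unfolding h_def using diff_exponents[OF e, of ?d]
        by (simp only: restrict_apply if_True low shift[OF that])
      have vanish: "f e = \<zero>" if "?low e" "\<not> e (Suc k) > 0"
        using e that by (intro Suc.prems(3)) (auto simp: atLeastAtMostSuc_conv)
      have "(X (Suc k) \<otimes>\<^bsub>P\<^esub> h) e = (if ?low e then f e else \<zero>)"
        unfolding coeff_monom_mult[OF h one_closed d e] le using he vanish fe by simp
      then show "f e = (X (Suc k) \<otimes>\<^bsub>P\<^esub> h \<oplus>\<^bsub>P\<^esub> g) e"
        using e fe by (simp add: coeff_add g_def)
    qed (use Suc.prems(1) X_closed g h in simp_all)
    ultimately show ?case by simp
  qed
qed

lemma exponent_eq_zero: "e \<in> E \<Longrightarrow> \<forall>i\<in>{1..m}. e i = 0 \<Longrightarrow> e = (\<lambda>i. 0)"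
  unfolding exponents_def by blast

lemma unit_exponent_neq_zero: "(\<lambda>i. 0) \<noteq> unit_exponent i"
  by (auto simp: unit_exponent_def fun_eq_iff)

lemma kernel_ideal: "ideal (a_kernel P R const_coeff) P"
proof -
  have "ring_hom_ring P R const_coeff"
    using ring_hom_cring.axioms(3)[OF const_coeff_hom] P.ring_axioms ring_axioms
    by (intro ring_hom_ringI2) (simp_all add: ring_hom_cring_axioms_def)
  then show ?thesis by (rule ring_hom_ring.kernel_is_ideal)
qed

lemma mem_kernel_iff: "f \<in> a_kernel P R const_coeff \<longleftrightarrow> f \<in> carrier P \<and> const_coeff f = \<zero>"
  unfolding a_kernel_def' by blast

lemma kernel_const_coeff: "a_kernel P R const_coeff = Idl\<^bsub>P\<^esub> (X ` {1..m})"
proof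
  show "Idl\<^bsub>P\<^esub> (X ` {1..m}) \<subseteq> a_kernel P R const_coeff"
  proof (rule P.genideal_minimal[OF kernel_ideal])
    show "X ` {1..m} \<subseteq> a_kernel P R const_coeff"
    proof
      fix f assume "f \<in> X ` {1..m}"
      then obtain i where "f = X i" by blast
      then have "f \<in> carrier P" "const_coeff f = \<zero>"
        using X_closed[of i] unit_exponent_neq_zero[of i] by (simp_all add: monom_def)
      then show "f \<in> a_kernel P R const_coeff" unfolding mem_kernel_iff by blast
    qed
  qed
  show "a_kernel P R const_coeff \<subseteq> Idl\<^bsub>P\<^esub> (X ` {1..m})"
  proof
    fix f assume "f \<in> a_kernel P R const_coeff"
    then have f: "f \<in> carrier P" "const_coeff f = \<zero>" unfolding mem_kernel_iff by blast+
    show "f \<in> Idl\<^bsub>P\<^esub> (X ` {1..m})"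
    proof (rule ideal_of_variables[OF f(1) order_refl])
      fix e assume "e \<in> E" "\<forall>i\<in>{1..m}. e i = 0"
      then have "e = (\<lambda>i. 0)" by (rule exponent_eq_zero)
      then show "f e = \<zero>" using f(2) by simp
    qed
  qed
qed

text \<open>This is where the specific ring enters: setting all variables to 0 has the finitely generated
kernel \<open>(x\<^sub>1, \<dots>, x\<^sub>m)\<close>, and a series with constant coefficient 1 is a unit.\<close>

lemma radical_quotient_const_coeff: "radical_quotient P R const_coeff"
proof (intro radical_quotient.intro radical_quotient_axioms.intro const_coeff_hom)
  show "const_coeff ` carrier P = carrier R"
  proof
    show "const_coeff ` carrier P \<subseteq> carrier R" using coeff_closed[OF _ zero_exponent] by blast
    show "carrier R \<subseteq> const_coeff ` carrier P"
    proof
      fix c assume "c \<in> carrier R"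
      then have closed: "monom c (\<lambda>i. 0) \<in> carrier P" by (rule monom_closed)
      have "c = const_coeff (monom c (\<lambda>i. 0))" by (simp add: monom_def)
      then show "c \<in> const_coeff ` carrier P"
        using closed by (rule image_eqI[of c const_coeff])
    qed
  qed
  show "fin_gen_ideal P (a_kernel P R const_coeff)"
    unfolding fin_gen_ideal_def kernel_const_coeff using X_closed
    by (intro exI[of _ "X ` {1..m}"]) auto
next
  fix u assume u: "u \<in> carrier P" "const_coeff u = \<one>"
  obtain g where g: "g \<in> carrier P" "u \<otimes>\<^bsub>P\<^esub> g = \<one>\<^bsub>P\<^esub>" using right_inverse[OF u] by blast
  moreover have "g \<otimes>\<^bsub>P\<^esub> u = \<one>\<^bsub>P\<^esub>" using mult_commute[OF g(1) u(1)] g(2) by simp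
  ultimately show "u \<in> Units P" unfolding Units_def using u(1) by blast
qed

text \<open>A nonzero element \<open>c\<close> of \<open>I\<close> is not a unit. Hence the ideal generated by the constant
series \<open>c\<close> and the ideal \<open>(x\<^sub>1, \<dots>, x\<^sub>m)\<close> are incomparable: the former does not contain
\<open>x\<^sub>1\<close>, the latter does not contain \<open>c\<close>.\<close>

lemma not_diam_le_1:
  assumes "m \<ge> 1" and I: "I \<in> proper_ideals R" "I \<noteq> {\<zero>}"
  shows "\<not> diam (GF P) \<le> ereal (real 1)"
proof
  assume le: "diam (GF P) \<le> ereal (real 1)"
  interpret I: ideal I R using I(1) by (rule proper_ideal)
  let ?K = "a_kernel P R const_coeff"
  obtain c where c: "c \<in> I" "c \<noteq> \<zero>" using I(2) I.zero_closed by blast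
  then have cC: "c \<in> carrier R" by (simp add: I.Icarr)
  let ?c = "monom c (\<lambda>i. 0)"
  let ?J = "PIdl\<^bsub>P\<^esub> ?c"
  have cP: "?c \<in> carrier P" using cC by (rule monom_closed)
  have J: "ideal ?J P" "?c \<in> ?J" using cP P.cgenideal_ideal P.cgenideal_self by auto
  have cK: "?c \<notin> ?K" using c(2) by (simp add: mem_kernel_iff monom_def)
  have one: "unit_exponent 1 \<in> E" using assms(1) by (intro unit_exponent_in) simp
  have XK: "X 1 \<in> ?K"
  proof -
    have "X ` {1..m} \<subseteq> carrier P" using X_closed by blast
    moreover have "X 1 \<in> X ` {1..m}" using assms(1) by simp
    ultimately show ?thesis
      unfolding kernel_const_coeff using P.genideal_self by blast
  qed
  have XJ: "X 1 \<notin> ?J"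
  proof
    assume "X 1 \<in> ?J"
    then obtain g where g: "g \<in> carrier P" "X 1 = g \<otimes>\<^bsub>P\<^esub> ?c"
      unfolding cgenideal_def by blast
    then have "X 1 (unit_exponent 1) = (?c \<otimes>\<^bsub>P\<^esub> g) (unit_exponent 1)"
      using mult_commute[OF cP] by simp
    then have "\<one> = c \<otimes> g (unit_exponent 1)"
      unfolding coeff_monom_mult[OF g(1) cC zero_exponent one] using one by (simp add: monom_def)
    moreover have "c \<otimes> g (unit_exponent 1) \<in> I"
      using c(1) coeff_closed[OF g(1) one] by (rule I.I_r_closed)
    ultimately show False using I(1) by (simp add: proper_iff_one_notin)
  qed
  have K: "?K \<in> proper_ideals P"
  proof -
    show ?thesis using kernel_ideal cK cP unfolding proper_ideals_def by blast
  qed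
  moreover have J': "?J \<in> proper_ideals P"
    using J XJ X_closed unfolding proper_ideals_def by blast
  ultimately have "(hop (GF P) ^^ 1) ?K ?J" using le unfolding diam_GF_le_iff by blast
  then have "hop (GF P) ?K ?J" by (simp only: relpowp_1)
  then have "?K \<subseteq> ?J \<or> ?J \<subseteq> ?K"
    unfolding P.hop_GF_iff using P.fg_extD(2) P.proper_subset_carrier K J' by blast
  then show False using J(2) cK XK XJ by blast
qed

end

section \<open>Power series in one variable over a field\<close>

context power_series
begin

text \<open>For \<open>m = 1\<close> this is the ideal generated by the \<open>k\<close>-th power of the variable.\<close>

definition order_ge :: "nat \<Rightarrow> ((nat \<Rightarrow> nat) \<Rightarrow> 'a) set" where
  "order_ge k = {f \<in> carrier P. \<forall>j<k. f (\<lambda>i. if i = 1 then j else 0) = \<zero>}"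

lemma order_ge_antimono: "j \<le> k \<Longrightarrow> order_ge k \<subseteq> order_ge j"
  by (auto simp: order_ge_def)

lemma divide_by_power:
  assumes "m = 1" and f: "f \<in> order_ge k"
  defines "d \<equiv> \<lambda>i. if i = 1 then k else 0"
  shows "\<exists>g\<in>carrier P. f = monom \<one> d \<otimes>\<^bsub>P\<^esub> g \<and> const_coeff g = f d"
proof (intro bexI conjI)
  have fP: "f \<in> carrier P" using f by (simp add: order_ge_def)
  have d: "d \<in> E" by (auto simp: d_def exponents_def assms(1))
  define g where "g = (\<lambda>e\<in>E. f (\<lambda>i. e i + d i))"
  show g: "g \<in> carrier P"
    unfolding g_def using coeff_closed[OF fP] add_exponents d by (intro restrict_in_P) simp
  show "const_coeff g = f d" by (simp add: g_def)
  show "f = monom \<one> d \<otimes>\<^bsub>P\<^esub> g"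
  proof (rule series_eqI)
    fix e assume e: "e \<in> E"
    have single: "e = (\<lambda>i. if i = 1 then e 1 else 0)"
      using e by (auto simp: exponents_def assms(1) fun_eq_iff)
    have fe: "f e \<in> carrier R" using fP e by (rule coeff_closed)
    show "f e = (monom \<one> d \<otimes>\<^bsub>P\<^esub> g) e"
    proof (cases "\<forall>i. d i \<le> e i")
      case True
      then have "(\<lambda>i. e i - d i + d i) = e" by simp
      then have "g (\<lambda>i. e i - d i) = f e"
        unfolding g_def using diff_exponents[OF e, of d] by (simp only: restrict_apply if_True)
      then show ?thesis
        using True fe by (simp add: coeff_monom_mult[OF g one_closed d e])
    next
      case False
      then have "e 1 < k" by (auto simp: d_def split: if_splits)
      then have "f (\<lambda>i. if i = 1 then e 1 else 0) = \<zero>" using f unfolding order_ge_def by blast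
      then have "f e = \<zero>" unfolding single[symmetric] .
      then show ?thesis
        unfolding coeff_monom_mult[OF g one_closed d e] if_not_P[OF False] .
    qed
  qed (use fP g monom_closed in simp_all)
qed

text \<open>With \<open>k\<close> the least order occurring in \<open>I\<close>, an element of order \<open>k\<close> is the \<open>k\<close>-th power of the
variable times a series \<open>g\<close> with nonzero constant coefficient. Such a \<open>g\<close> is a unit because its
image in the field generates the unit ideal, and so the power itself belongs to \<open>I\<close>.\<close>

lemma ideal_eq_order_ge:
  assumes m: "m = 1" and field: "proper_ideals R = {{\<zero>}}"
    and I: "ideal I P" "I \<noteq> {\<zero>\<^bsub>P\<^esub>}"
  shows "\<exists>k. I = order_ge k \<and> I = PIdl\<^bsub>P\<^esub> (monom \<one> (\<lambda>i. if i = 1 then k else 0))"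
proof -
  interpret I: ideal I P by fact
  let ?d = "\<lambda>k i. if i = 1 then k else 0 :: nat"
  have d: "?d k \<in> E" for k by (auto simp: exponents_def m)
  have single: "e = ?d (e 1)" if "e \<in> E" for e
    using that by (auto simp: exponents_def m fun_eq_iff)
  let ?ne = "\<lambda>k. \<exists>f\<in>I. f (?d k) \<noteq> \<zero>"
  obtain f where f: "f \<in> I" "f \<noteq> \<zero>\<^bsub>P\<^esub>" using I(2) I.zero_closed by blast
  have "\<exists>e\<in>E. f e \<noteq> \<zero>"
  proof (rule ccontr)
    assume "\<not> (\<exists>e\<in>E. f e \<noteq> \<zero>)"
    then have "f = \<zero>\<^bsub>P\<^esub>" using I.Icarr[OF f(1)] by (intro series_eqI) (auto simp: coeff_zero)
    then show False using f(2) by simp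
  qed
  then obtain e where e: "e \<in> E" "f e \<noteq> \<zero>" by blast
  then have "f (?d (e 1)) \<noteq> \<zero>" using single[OF e(1)] by metis
  then have ex: "?ne (e 1)" using f(1) by blast
  define k where "k = (LEAST k. ?ne k)"
  have "?ne k" unfolding k_def using ex by (rule LeastI)
  then obtain f0 where f0: "f0 \<in> I" "f0 (?d k) \<noteq> \<zero>" by blast
  have least: "f (?d j) = \<zero>" if "f \<in> I" "j < k" for f j
    using not_less_Least[of j ?ne] that unfolding k_def by blast
  have sub: "I \<subseteq> order_ge k"
    unfolding order_ge_def using least I.Icarr by blast
  let ?x = "monom \<one> (?d k)"
  have xP: "?x \<in> carrier P" by (intro monom_closed) simp
  obtain g where g: "g \<in> carrier P" "f0 = ?x \<otimes>\<^bsub>P\<^esub> g" "const_coeff g = f0 (?d k)"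
    using divide_by_power[OF m] f0(1) sub by blast
  have "PIdl\<^bsub>P\<^esub> g \<notin> proper_ideals P"
  proof
    assume "PIdl\<^bsub>P\<^esub> g \<in> proper_ideals P"
    then have "const_coeff ` (PIdl\<^bsub>P\<^esub> g) \<in> proper_ideals R" by (rule radical_quotient.image_proper[OF radical_quotient_const_coeff])
    then have zero: "const_coeff ` (PIdl\<^bsub>P\<^esub> g) = {\<zero>}" unfolding field by (rule singletonD)
    have "g \<in> PIdl\<^bsub>P\<^esub> g" using g(1) by (rule P.cgenideal_self)
    then have "const_coeff g \<in> const_coeff ` (PIdl\<^bsub>P\<^esub> g)" by (rule imageI[of g _ const_coeff])
    then have "const_coeff g = \<zero>" unfolding zero by (rule singletonD)
    then show False using g(3) f0(2) by metis
  qed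
  then have "\<one>\<^bsub>P\<^esub> \<in> PIdl\<^bsub>P\<^esub> g"
    using P.cgenideal_ideal[OF g(1)] unfolding P.proper_iff_one_notin by blast
  then obtain u where u: "u \<in> carrier P" "\<one>\<^bsub>P\<^esub> = u \<otimes>\<^bsub>P\<^esub> g" unfolding cgenideal_def by blast
  have "?x = ?x \<otimes>\<^bsub>P\<^esub> \<one>\<^bsub>P\<^esub>" using xP by (simp only: P.r_one)
  also have "\<dots> = u \<otimes>\<^bsub>P\<^esub> f0"
    unfolding u(2) g(2) using xP u(1) g(1) by (rule P.m_lcomm)
  also have "\<dots> \<in> I" using f0(1) u(1) by (rule I.I_l_closed)
  finally have xI: "?x \<in> I" .
  have "order_ge k \<subseteq> PIdl\<^bsub>P\<^esub> ?x"
  proof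
    fix f assume "f \<in> order_ge k"
    then obtain g where "g \<in> carrier P" "f = ?x \<otimes>\<^bsub>P\<^esub> g"
      using divide_by_power[OF m] by blast
    then show "f \<in> PIdl\<^bsub>P\<^esub> ?x"
      unfolding cgenideal_def using P.m_comm[OF xP] by blast
  qed
  moreover have "PIdl\<^bsub>P\<^esub> ?x \<subseteq> I" using I(1) xI by (rule P.cgenideal_minimal)
  ultimately show ?thesis using sub by blast
qed

lemma diam_field:
  assumes m: "m = 1" and field: "proper_ideals R = {{\<zero>}}"
  shows "diam (GF P) \<le> ereal (real 1)" "\<not> diam (GF P) \<le> ereal (real 0)"
proof -
  have ext: "fg_ext P I J" if J: "ideal J P" "I \<subseteq> J" and a: "a \<in> carrier P" "J = PIdl\<^bsub>P\<^esub> a" for I J a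
  proof -
    have IC: "I \<union> {a} \<subseteq> carrier P" using J a(1) ideal.subset_carrier[OF J(1)] by simp
    have aJ: "a \<in> J" unfolding a(2) using a(1) by (rule P.cgenideal_self)
    have "Idl\<^bsub>P\<^esub> (I \<union> {a}) \<subseteq> J" using J aJ by (intro P.genideal_minimal) simp_all
    moreover have "J \<subseteq> Idl\<^bsub>P\<^esub> (I \<union> {a})"
      unfolding a(2) using P.genideal_ideal[OF IC] P.genideal_self[OF IC]
      by (intro P.cgenideal_minimal) simp_all
    ultimately show ?thesis
      unfolding fg_ext_def using a(1) by (intro exI[of _ "{a}"] conjI equalityI) simp_all
  qed
  have hop: "hop (GF P) I J" if IJ: "I \<in> proper_ideals P" "J \<in> proper_ideals P" for I J
  proof -
    have id: "ideal I P" "ideal J P" using IJ P.proper_ideal by auto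
    note z = additive_subgroup.zero_closed[OF ideal.axioms(1)]
    have c1: "\<one> \<in> carrier R" by simp
    consider "I = {\<zero>\<^bsub>P\<^esub>}" "J = {\<zero>\<^bsub>P\<^esub>}" | (I0) "I = {\<zero>\<^bsub>P\<^esub>}" "J \<noteq> {\<zero>\<^bsub>P\<^esub>}"
      | (J0) "I \<noteq> {\<zero>\<^bsub>P\<^esub>}" "J = {\<zero>\<^bsub>P\<^esub>}" | (ne) "I \<noteq> {\<zero>\<^bsub>P\<^esub>}" "J \<noteq> {\<zero>\<^bsub>P\<^esub>}" by blast
    then have "fg_ext P I J \<or> fg_ext P J I"
    proof cases
      case 1
      then show ?thesis using P.fg_ext_refl[OF id(1)] by simp
    next
      case I0
      then obtain k where k: "J = PIdl\<^bsub>P\<^esub> (monom \<one> (\<lambda>i. if i = 1 then k else 0))"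
        using ideal_eq_order_ge[OF m field id(2)] by blast
      have "I \<subseteq> J" using I0(1) z[OF id(2)] by simp
      then show ?thesis using ext[OF id(2) _ monom_closed[OF c1] k] by blast
    next
      case J0
      then obtain k where k: "I = PIdl\<^bsub>P\<^esub> (monom \<one> (\<lambda>i. if i = 1 then k else 0))"
        using ideal_eq_order_ge[OF m field id(1)] by blast
      have "J \<subseteq> I" using J0(2) z[OF id(1)] by simp
      then show ?thesis using ext[OF id(1) _ monom_closed[OF c1] k] by blast
    next
      case ne
      obtain k where k: "I = order_ge k" "I = PIdl\<^bsub>P\<^esub> (monom \<one> (\<lambda>i. if i = 1 then k else 0))"
        using ideal_eq_order_ge[OF m field id(1) ne(1)] by blast
      obtain l where l: "J = order_ge l" "J = PIdl\<^bsub>P\<^esub> (monom \<one> (\<lambda>i. if i = 1 then l else 0))"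
        using ideal_eq_order_ge[OF m field id(2) ne(2)] by blast
      have "I \<subseteq> J \<or> J \<subseteq> I"
        unfolding k(1) l(1) using order_ge_antimono[of k l] order_ge_antimono[of l k] nat_le_linear by blast
      then show ?thesis
        using ext[OF id(2) _ monom_closed[OF c1] l(2)] ext[OF id(1) _ monom_closed[OF c1] k(2)]
        by blast
    qed
    then show ?thesis unfolding P.hop_GF_iff using IJ by blast
  qed
  have "(hop (GF P) ^^ 1) I J" if "I \<in> proper_ideals P" "J \<in> proper_ideals P" for I J
    using hop[OF that] by (simp only: relpowp_1)
  then show "diam (GF P) \<le> ereal (real 1)" unfolding diam_GF_le_iff by blast
  have one: "\<one> \<noteq> \<zero>"
  proof
    assume "\<one> = \<zero>"
    moreover have "{\<zero>} \<in> proper_ideals R" using field by simp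
    ultimately show False unfolding proper_iff_one_notin by simp
  qed
  let ?K = "a_kernel P R const_coeff"
  have u1: "unit_exponent 1 \<in> E" using m by (intro unit_exponent_in) simp
  have X1: "X 1 \<in> ?K"
    unfolding mem_kernel_iff using X_closed[of 1] unit_exponent_neq_zero[of 1]
    by (simp add: monom_def)
  have "X 1 (unit_exponent 1) = \<one>" "\<zero>\<^bsub>P\<^esub> (unit_exponent 1) = \<zero>"
    using u1 by (simp_all add: monom_def coeff_zero)
  then have X0: "X 1 \<noteq> \<zero>\<^bsub>P\<^esub>" using one by metis
  have "const_coeff \<one>\<^bsub>P\<^esub> = \<one>" by (simp add: one_eq_monom monom_def)
  then have "\<one>\<^bsub>P\<^esub> \<notin> ?K" unfolding mem_kernel_iff using one by simp
  then have K: "?K \<in> proper_ideals P" unfolding P.proper_iff_one_notin using kernel_ideal by blast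
  have z: "\<zero>\<^bsub>P\<^esub> \<in> ?K" by (rule additive_subgroup.zero_closed[OF ideal.axioms(1)[OF kernel_ideal]])
  then have Z: "{\<zero>\<^bsub>P\<^esub>} \<in> proper_ideals P"
    using K P.zeroideal P.proper_subideal by blast
  show "\<not> diam (GF P) \<le> ereal (real 0)"
  proof
    assume "diam (GF P) \<le> ereal (real 0)"
    then have "(hop (GF P) ^^ 0) ?K {\<zero>\<^bsub>P\<^esub>}" unfolding diam_GF_le_iff using K Z by blast
    then have "?K = {\<zero>\<^bsub>P\<^esub>}" by (simp only: relpowp.simps)
    then show False using X1 X0 by blast
  qed
qed

end

section \<open>The diameters\<close>

text \<open>The diameter 0 excludes the zero ring, whose graph has no vertex and diameter \<open>-\<infinity>\<close>. There is
exactly one vertex, so it has to be the zero ideal.\<close>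

lemma (in cring) proper_ideals_of_diam_0:
  assumes "diam (GF R) = 0"
  shows "proper_ideals R = {{\<zero>}}"
proof -
  have "proper_ideals R \<noteq> {}"
  proof
    assume "proper_ideals R = {}"
    then have "diam (GF R) = - \<infinity>" by (simp add: diam_def bot_ereal_def)
    then show False using assms by simp
  qed
  then obtain I where I: "I \<in> proper_ideals R" by blast
  have "\<zero> \<in> I" by (rule additive_subgroup.zero_closed[OF ideal.axioms(1)[OF proper_ideal[OF I]]])
  then have Z: "{\<zero>} \<in> proper_ideals R"
    using I zeroideal proper_subideal by blast
  have "diam (GF R) \<le> ereal (real 0)" using assms by simp
  then have eq: "(hop (GF R) ^^ 0) J {\<zero>}" if "J \<in> proper_ideals R" for J
    unfolding diam_GF_le_iff using Z that by blast
  then have "J = {\<zero>}" if "J \<in> proper_ideals R" for J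
    using eq[OF that] by (simp only: relpowp.simps)
  then show ?thesis using Z by blast
qed

lemma (in cring) nonzero_proper_ideal:
  assumes "\<not> diam (GF R) \<le> ereal (real 0)"
  shows "\<exists>I\<in>proper_ideals R. I \<noteq> {\<zero>}"
proof -
  obtain I J where IJ: "I \<in> proper_ideals R" "J \<in> proper_ideals R" "\<not> (hop (GF R) ^^ 0) I J"
    using assms unfolding diam_GF_le_iff by blast
  have "I \<noteq> J" using IJ(3) by simp
  then show ?thesis using IJ by metis
qed

lemma diam_GF_eqI:
  assumes "diam (GF T) \<le> ereal (real (Suc k))" "\<not> diam (GF T) \<le> ereal (real k)"
  shows "diam (GF T) = ereal (real (Suc k))"
  using assms(1) diam_GF_ge_Suc[OF assms(2)] by (rule antisym)

theorem theorem6p18: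
  fixes R :: "('a, 'b) ring_scheme" and m :: nat and n :: ereal
  assumes "cring R" and "m \<ge> 1" and "diam (GF R) = n"
  shows "(n = 0 \<longrightarrow> diam (GF (power_series_ring R 1)) = 1) \<and>
         (n = 1 \<longrightarrow> diam (GF (power_series_ring R m)) = 2) \<and>
         (n = 2 \<longrightarrow> diam (GF (power_series_ring R m)) = 2) \<and>
         (n \<in> {3, 4, \<infinity>} \<longrightarrow> diam (GF (power_series_ring R m)) = n)"
proof -
  let ?P = "power_series_ring R m"
  have ps: "power_series R" using assms(1) by (rule power_series.intro)
  interpret q: radical_quotient ?P R "\<lambda>f. f (\<lambda>i. 0)"
    using ps by (rule power_series.radical_quotient_const_coeff)
  have down: "diam (GF R) \<le> ereal (real k)" if "diam (GF ?P) \<le> ereal (real k)" for k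
    using that by (rule q.diam_quotient_le)
  have "diam (GF (power_series_ring R 1)) = 1" if n: "n = 0"
  proof -
    have f: "proper_ideals R = {{\<zero>\<^bsub>R\<^esub>}}"
      using assms(3) n by (intro cring.proper_ideals_of_diam_0[OF assms(1)]) simp
    have "diam (GF (power_series_ring R 1)) = ereal (real (Suc 0))"
      using power_series.diam_field[OF ps refl f] by (intro diam_GF_eqI) simp_all
    then show ?thesis by (simp add: one_ereal_def)
  qed
  moreover have "diam (GF ?P) = 2" if n: "n = 1 \<or> n = 2"
  proof -
    have "diam (GF R) \<le> ereal (real 2)" using n assms(3) by auto
    then have le: "diam (GF ?P) \<le> ereal (real 2)" by (rule q.diam_lift_le_2)
    have "\<not> diam (GF R) \<le> ereal (real 0)" using n assms(3) by auto
    then obtain I where "I \<in> proper_ideals R" "I \<noteq> {\<zero>\<^bsub>R\<^esub>}"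
      using cring.nonzero_proper_ideal[OF assms(1)] by blast
    then have "\<not> diam (GF ?P) \<le> ereal (real 1)"
      by (rule power_series.not_diam_le_1[OF ps assms(2)])
    then have "diam (GF ?P) = ereal (real (Suc 1))" using le by (intro diam_GF_eqI) simp_all
    then show ?thesis by simp
  qed
  moreover have "diam (GF ?P) = n" if n: "n = 3"
  proof -
    have "diam (GF R) \<le> ereal (real 3)" using n assms(3) by simp
    then have "diam (GF ?P) \<le> ereal (real 3)" by (rule q.diam_lift_le_3)
    moreover have "\<not> diam (GF ?P) \<le> ereal (real 2)" using down[of 2] n assms(3) by auto
    ultimately have "diam (GF ?P) = ereal (real (Suc 2))" by (intro diam_GF_eqI) simp_all
    then show ?thesis using n by simp
  qed
  moreover have "diam (GF ?P) = n" if n: "n = 4"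
  proof -
    have "diam (GF R) \<le> ereal (real 4)" using n assms(3) by simp
    then have "diam (GF ?P) \<le> ereal (real 4)" by (rule q.diam_lift_le_4)
    moreover have "\<not> diam (GF ?P) \<le> ereal (real 3)" using down[of 3] n assms(3) by auto
    ultimately have "diam (GF ?P) = ereal (real (Suc 3))" by (intro diam_GF_eqI) simp_all
    then show ?thesis using n by simp
  qed
  moreover have "diam (GF ?P) = n" if n: "n = \<infinity>"
  proof (rule ccontr)
    assume "diam (GF ?P) \<noteq> n"
    then have "\<exists>k. diam (GF ?P) \<le> ereal (real k)"
      using n by (cases "diam (GF ?P)") (auto intro: real_arch_simple)
    then show False using down n assms(3) by auto
  qed
  ultimately show ?thesis by blast
qed

end
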